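(* For any countable bi-modal Gödel algebra $A$ there is a GK-frame $\mathcal{F}_A=(W,S)$ such that: (i) $A$ is embeddable (as a bi-modal Gödel algebra) in the Gödel complex algebra $[0,1]^{\mathcal{F}_A}$. (ii) For any valuation $v:Var\to A$ there is a function $e_v:W\times Var\to[0,1]$ such that for every formula $\varphi\in\mathcal{L}_{\square\Diamond}(Var)$, $v(\varphi)=1$ if and only if $(W,S,e_v)\models\varphi$.
   Context: A Gödel algebra is a Heyting algebra satisfying $(x\Rightarrow y)\curlyvee(y\Rightarrow x)=1$ (meet is written $\cdot$, join $\curlyvee$, residuum $\Rightarrow$ or $\rightarrow$). The standard Gödel algebra is $[0,1]$ with $a\cdot b=\min(a,b)$, $a\curlyvee b=\max(a,b)$, and $a\Rightarrow b=1$ if $a\le b$, $a\Rightarrow b=b$ otherwise. A bi-modal Gödel algebra is $A=(G,I,K)$ with $G$ a Gödel algebra and $I,K$ unary operations on $G$ satisfying $I(a\cdot b)=Ia\cdot Ib$, $I1=1$, $K(a\curlyvee b)=Ka\curlyvee Kb$, $K0=0$, $(Ka\Rightarrow Ib)\le I(a\Rightarrow b)$, $K(a\Rightarrow b)\le(Ia\Rightarrow Kb)$. $Var$ is a set of propositional variables; $\mathcal{L}_{\square\Diamond}(Var)$ is the set of formulas built from $Var$ and $\bot$ using $\wedge,\vee,\rightarrow$ and the unary operators $\square,\Diamond$. A valuation $v:Var\to A$ extends to $\mathcal{L}_{\square\Diamond}(Var)$ by interpreting $\bot,\wedge,\vee,\rightarrow$ by the Heyting operations and $\square,\Diamond$ by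 $I,K$. A GK-frame is a pair $(W,S)$ with $W$ a non-empty set and $S:W\times W\to[0,1]$; a GK-model over it is $(W,S,e)$ with $e:W\times Var\to[0,1]$. The function $e$ extends to all formulas by $e(x,\bot)=0$, $e(x,\varphi\wedge\psi)=e(x,\varphi)\cdot e(x,\psi)$, $e(x,\varphi\vee\psi)=e(x,\varphi)\curlyvee e(x,\psi)$, $e(x,\varphi\rightarrow\psi)=e(x,\varphi)\Rightarrow e(x,\psi)$, $e(x,\square\varphi)=\inf_{y\in W}\{Sxy\Rightarrow e(y,\varphi)\}$, $e(x,\Diamond\varphi)=\sup_{y\in W}\{Sxy\cdot e(y,\varphi)\}$. $(W,S,e)\models\varphi$ means $e(x,\varphi)=1$ for all $x\in W$. For a GK-frame $\mathcal{F}=(W,S)$, the Gödel complex algebra is $[0,1]^{\mathcal{F}}=([0,1]^W,I^{\mathcal{F}},K^{\mathcal{F}})$, where $[0,1]^W$ is the product Gödel algebra and $I^{\mathcal{F}}(f)(w)=\inf_{w'\in W}(Sww'\Rightarrow f(w'))$, $K^{\mathcal{F}}(f)(w)=\sup_{w'\in W}(Sww'\cdot f(w'))$ for $f\in[0,1]^W$. An embedding is an injective homomorphism of bi-modal Gödel algebras.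
   Formalization: The algebra A is assumed to satisfy 0 ≠ 1; for the one-element algebra the claim fails, since W is non-empty, so no homomorphism into the complex algebra preserves both 0 and 1, and v(⊥)=1 while no GK-model validates ⊥. *)

theory Defs
  imports Complex_Main "HOL-Library.FuncSet" "HOL-Library.Countable_Set" "HOL-Algebra.Congruence"
begin

section \<open>Goedel algebras and bi-modal Goedel algebras\<close>

record 'a bimodal_algebra = "'a partial_object" +
  alg_meet :: "'a \<Rightarrow> 'a \<Rightarrow> 'a"
  alg_join :: "'a \<Rightarrow> 'a \<Rightarrow> 'a"
  alg_imp :: "'a \<Rightarrow> 'a \<Rightarrow> 'a"
  alg_bot :: 'a
  alg_top :: 'a
  alg_box :: "'a \<Rightarrow> 'a"
  alg_dia :: "'a \<Rightarrow> 'a"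

definition alg_le :: "'a bimodal_algebra \<Rightarrow> 'a \<Rightarrow> 'a \<Rightarrow> bool" where
  "alg_le A a b \<longleftrightarrow> alg_meet A a b = a"

text \<open>As is usual in algebra, the degenerate one-element algebra is a Heyting algebra here.
  The two unary operations are irrelevant to this and the next locale.\<close>

locale heyting_algebra =
  fixes A :: "'a bimodal_algebra"
  assumes meet_closed: "\<lbrakk>a \<in> carrier A; b \<in> carrier A\<rbrakk> \<Longrightarrow> alg_meet A a b \<in> carrier A"
    and join_closed: "\<lbrakk>a \<in> carrier A; b \<in> carrier A\<rbrakk> \<Longrightarrow> alg_join A a b \<in> carrier A"
    and imp_closed: "\<lbrakk>a \<in> carrier A; b \<in> carrier A\<rbrakk> \<Longrightarrow> alg_imp A a b \<in> carrier A"
    and bot_closed: "alg_bot A \<in> carrier A"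
    and top_closed: "alg_top A \<in> carrier A"
    and meet_assoc: "\<lbrakk>a \<in> carrier A; b \<in> carrier A; c \<in> carrier A\<rbrakk>
      \<Longrightarrow> alg_meet A (alg_meet A a b) c = alg_meet A a (alg_meet A b c)"
    and join_assoc: "\<lbrakk>a \<in> carrier A; b \<in> carrier A; c \<in> carrier A\<rbrakk>
      \<Longrightarrow> alg_join A (alg_join A a b) c = alg_join A a (alg_join A b c)"
    and meet_comm: "\<lbrakk>a \<in> carrier A; b \<in> carrier A\<rbrakk> \<Longrightarrow> alg_meet A a b = alg_meet A b a"
    and join_comm: "\<lbrakk>a \<in> carrier A; b \<in> carrier A\<rbrakk> \<Longrightarrow> alg_join A a b = alg_join A b a"
    and meet_absorb: "\<lbrakk>a \<in> carrier A; b \<in> carrier A\<rbrakk> \<Longrightarrow> alg_meet A a (alg_join A a b) = a"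
    and join_absorb: "\<lbrakk>a \<in> carrier A; b \<in> carrier A\<rbrakk> \<Longrightarrow> alg_join A a (alg_meet A a b) = a"
    and bot_least: "a \<in> carrier A \<Longrightarrow> alg_le A (alg_bot A) a"
    and top_greatest: "a \<in> carrier A \<Longrightarrow> alg_le A a (alg_top A)"
    and residuation: "\<lbrakk>a \<in> carrier A; b \<in> carrier A; c \<in> carrier A\<rbrakk>
      \<Longrightarrow> alg_le A (alg_meet A a b) c \<longleftrightarrow> alg_le A a (alg_imp A b c)"

locale godel_algebra = heyting_algebra +
  assumes prelinearity: "\<lbrakk>a \<in> carrier A; b \<in> carrier A\<rbrakk>
    \<Longrightarrow> alg_join A (alg_imp A a b) (alg_imp A b a) = alg_top A"

locale bimodal_godel_algebra = godel_algebra +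
  assumes box_closed: "a \<in> carrier A \<Longrightarrow> alg_box A a \<in> carrier A"
    and dia_closed: "a \<in> carrier A \<Longrightarrow> alg_dia A a \<in> carrier A"
    and box_meet: "\<lbrakk>a \<in> carrier A; b \<in> carrier A\<rbrakk>
      \<Longrightarrow> alg_box A (alg_meet A a b) = alg_meet A (alg_box A a) (alg_box A b)"
    and box_top: "alg_box A (alg_top A) = alg_top A"
    and dia_join: "\<lbrakk>a \<in> carrier A; b \<in> carrier A\<rbrakk>
      \<Longrightarrow> alg_dia A (alg_join A a b) = alg_join A (alg_dia A a) (alg_dia A b)"
    and dia_bot: "alg_dia A (alg_bot A) = alg_bot A"
    and dia_imp_box: "\<lbrakk>a \<in> carrier A; b \<in> carrier A\<rbrakk>
      \<Longrightarrow> alg_le A (alg_imp A (alg_dia A a) (alg_box A b)) (alg_box A (alg_imp A a b))"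
    and dia_imp: "\<lbrakk>a \<in> carrier A; b \<in> carrier A\<rbrakk>
      \<Longrightarrow> alg_le A (alg_dia A (alg_imp A a b)) (alg_imp A (alg_box A a) (alg_dia A b))"

definition bimodal_hom :: "'a bimodal_algebra \<Rightarrow> 'b bimodal_algebra \<Rightarrow> ('a \<Rightarrow> 'b) \<Rightarrow> bool" where
  "bimodal_hom A B h \<longleftrightarrow>
     h \<in> carrier A \<rightarrow> carrier B \<and>
     (\<forall>a\<in>carrier A. \<forall>b\<in>carrier A.
        h (alg_meet A a b) = alg_meet B (h a) (h b) \<and>
        h (alg_join A a b) = alg_join B (h a) (h b) \<and>
        h (alg_imp A a b) = alg_imp B (h a) (h b)) \<and>
     h (alg_bot A) = alg_bot B \<and>
     h (alg_top A) = alg_top B \<and>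
     (\<forall>a\<in>carrier A. h (alg_box A a) = alg_box B (h a) \<and> h (alg_dia A a) = alg_dia B (h a))"

definition bimodal_embedding :: "'a bimodal_algebra \<Rightarrow> 'b bimodal_algebra \<Rightarrow> ('a \<Rightarrow> 'b) \<Rightarrow> bool" where
  "bimodal_embedding A B h \<longleftrightarrow> bimodal_hom A B h \<and> inj_on h (carrier A)"

section \<open>Formulas and their algebraic interpretation\<close>

datatype 'v formula =
    Atom 'v
  | Falsum
  | Conj "'v formula" "'v formula"
  | Disj "'v formula" "'v formula"
  | Impl "'v formula" "'v formula"
  | Box "'v formula"
  | Dia "'v formula"

definition alg_valuation :: "'a bimodal_algebra \<Rightarrow> ('v \<Rightarrow> 'a) \<Rightarrow> bool" where
  "alg_valuation A v \<longleftrightarrow> (\<forall>p. v p \<in> carrier A)"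

primrec alg_eval :: "'a bimodal_algebra \<Rightarrow> ('v \<Rightarrow> 'a) \<Rightarrow> 'v formula \<Rightarrow> 'a" where
  "alg_eval A v (Atom p) = v p"
| "alg_eval A v Falsum = alg_bot A"
| "alg_eval A v (Conj \<phi> \<psi>) = alg_meet A (alg_eval A v \<phi>) (alg_eval A v \<psi>)"
| "alg_eval A v (Disj \<phi> \<psi>) = alg_join A (alg_eval A v \<phi>) (alg_eval A v \<psi>)"
| "alg_eval A v (Impl \<phi> \<psi>) = alg_imp A (alg_eval A v \<phi>) (alg_eval A v \<psi>)"
| "alg_eval A v (Box \<phi>) = alg_box A (alg_eval A v \<phi>)"
| "alg_eval A v (Dia \<phi>) = alg_dia A (alg_eval A v \<phi>)"

section \<open>GK-frames, GK-models and complex algebras\<close>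

definition godel_imp :: "real \<Rightarrow> real \<Rightarrow> real" where
  "godel_imp a b = (if a \<le> b then 1 else b)"

definition gk_frame :: "'w set \<Rightarrow> ('w \<Rightarrow> 'w \<Rightarrow> real) \<Rightarrow> bool" where
  "gk_frame W S \<longleftrightarrow> W \<noteq> {} \<and> (\<forall>x\<in>W. \<forall>y\<in>W. S x y \<in> {0..1})"

definition gk_model :: "'w set \<Rightarrow> ('w \<Rightarrow> 'w \<Rightarrow> real) \<Rightarrow> ('w \<Rightarrow> 'v \<Rightarrow> real) \<Rightarrow> bool" where
  "gk_model W S e \<longleftrightarrow> gk_frame W S \<and> (\<forall>x\<in>W. \<forall>p. e x p \<in> {0..1})"

text \<open>Infima and suprema are those of the conditionally complete lattice \<^typ>\<open>real\<close>; over a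
  GK-model all index sets are non-empty and all values lie in the unit interval, so they coincide
  with the ones of the complete lattice \<open>[0,1]\<close>.\<close>

primrec gk_eval ::
  "'w set \<Rightarrow> ('w \<Rightarrow> 'w \<Rightarrow> real) \<Rightarrow> ('w \<Rightarrow> 'v \<Rightarrow> real) \<Rightarrow> 'w \<Rightarrow> 'v formula \<Rightarrow> real" where
  "gk_eval W S e x (Atom p) = e x p"
| "gk_eval W S e x Falsum = 0"
| "gk_eval W S e x (Conj \<phi> \<psi>) = min (gk_eval W S e x \<phi>) (gk_eval W S e x \<psi>)"
| "gk_eval W S e x (Disj \<phi> \<psi>) = max (gk_eval W S e x \<phi>) (gk_eval W S e x \<psi>)"
| "gk_eval W S e x (Impl \<phi> \<psi>) = godel_imp (gk_eval W S e x \<phi>) (gk_eval W S e x \<psi>)"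
| "gk_eval W S e x (Box \<phi>) = (INF y\<in>W. godel_imp (S x y) (gk_eval W S e y \<phi>))"
| "gk_eval W S e x (Dia \<phi>) = (SUP y\<in>W. min (S x y) (gk_eval W S e y \<phi>))"

definition gk_valid ::
  "'w set \<Rightarrow> ('w \<Rightarrow> 'w \<Rightarrow> real) \<Rightarrow> ('w \<Rightarrow> 'v \<Rightarrow> real) \<Rightarrow> 'v formula \<Rightarrow> bool" where
  "gk_valid W S e \<phi> \<longleftrightarrow> (\<forall>x\<in>W. gk_eval W S e x \<phi> = 1)"

text \<open>Elements of \<open>[0,1]\<^sup>W\<close> are extensional functions, so that equality of HOL functions is
  equality on \<open>W\<close>.\<close>

definition complex_algebra :: "'w set \<Rightarrow> ('w \<Rightarrow> 'w \<Rightarrow> real) \<Rightarrow> ('w \<Rightarrow> real) bimodal_algebra" where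
  "complex_algebra W S =
     \<lparr>carrier = W \<rightarrow>\<^sub>E {0..1},
      alg_meet = (\<lambda>f g. \<lambda>w\<in>W. min (f w) (g w)),
      alg_join = (\<lambda>f g. \<lambda>w\<in>W. max (f w) (g w)),
      alg_imp = (\<lambda>f g. \<lambda>w\<in>W. godel_imp (f w) (g w)),
      alg_bot = (\<lambda>w\<in>W. 0),
      alg_top = (\<lambda>w\<in>W. 1),
      alg_box = (\<lambda>f. \<lambda>w\<in>W. INF w'\<in>W. godel_imp (S w w') (f w')),
      alg_dia = (\<lambda>f. \<lambda>w\<in>W. SUP w'\<in>W. min (S w w') (f w'))\<rparr>"

end

theory Submission
  imports Defs
begin

text \<open>
  The worlds are Goedel homomorphisms \<open>w : A \<rightarrow> [0,1]\<close>, an element \<open>a\<close> is sent to \<open>w \<mapsto> w a\<close>, and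
  \<open>S v w\<close> is the largest degree compatible with \<open>v (\<box>b)\<close> and \<open>v (\<diamond>b)\<close> for all \<open>b\<close>. It suffices that
  the chosen homomorphisms separate the elements of \<open>A\<close> and that each of them has successors that
  witness its values at \<open>\<box>a\<close> and \<open>\<diamond>a\<close>.

  Inside a fixed copy of \<open>[0,1]\<close> a successor need not exist, because the cut that a value of \<open>w\<close> has to
  fill may be empty. Hence the order comes first: a homomorphism up to the choice of values is a prime
  filter, and worlds are added one at a time, each new chain \<open>A/G\<close> being amalgamated with the
  countable chain of all values used so far. The successor for \<open>\<box>a\<close> at \<open>v\<close> is placed
  above \<open>v (\<box>a)\<close> but below a prescribed larger value, and all larger values are prescribed in turn.
  The limit chain is countable and is embedded into \<open>[0,1]\<close> by a map that preserves infima.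
\<close>

section \<open>Heyting algebras and prime filters\<close>

text \<open>Accessibility to degree s constrains a successor of v only below s. The values of v that
  count as lying above s form a prime filter \<open>F\<close> containing the truth filter
  \<open>M\<close> of v, and whatever reaches this cut may be collapsed to 1. So the truth filter
  \<open>G\<close> of the successor only has to satisfy: \<box>b \<in> F implies b \<in> G, and b
  \<in> G implies \<diamond>b \<in> F. Each of the two axioms that mix I and K is used twice: once
  to find \<open>G\<close>, and once to show that \<box>b \<le> w b for all b and w b \<le>
  \<diamond>b for b outside \<open>G\<close> are compatible with the order of A/G.

  For \<box>a the degree must be strictly above w a, since otherwise the Goedel implication jumps to
  1, and yet at most v (\<diamond>b) for every b \<in> G. The chain A/G may have no element between
  a and 1 to serve as this degree, so every world carries one auxiliary point for it.

  Countability is used for listing all requests for successors and for embedding the limit chain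
  into the reals.\<close>

context heyting_algebra
begin

lemma le_refl: "a \<in> carrier A \<Longrightarrow> alg_le A a a"
  unfolding alg_le_def by (metis meet_absorb join_absorb meet_closed)

lemma le_antisym: "\<lbrakk>alg_le A a b; alg_le A b a; a \<in> carrier A; b \<in> carrier A\<rbrakk> \<Longrightarrow> a = b"
  unfolding alg_le_def by (metis meet_comm)

lemma le_trans: "\<lbrakk>alg_le A a b; alg_le A b c; a \<in> carrier A; b \<in> carrier A; c \<in> carrier A\<rbrakk> \<Longrightarrow> alg_le A a c"
  unfolding alg_le_def by (metis meet_assoc)

lemma meet_idem: "a \<in> carrier A \<Longrightarrow> alg_meet A a a = a"
  using le_refl by (simp add: alg_le_def)

lemma meet_le1: "\<lbrakk>a \<in> carrier A; b \<in> carrier A\<rbrakk> \<Longrightarrow> alg_le A (alg_meet A a b) a"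
  unfolding alg_le_def by (metis meet_assoc meet_comm meet_closed meet_idem)

lemma meet_le2: "\<lbrakk>a \<in> carrier A; b \<in> carrier A\<rbrakk> \<Longrightarrow> alg_le A (alg_meet A a b) b"
  by (metis meet_le1 meet_comm)

lemma meet_greatest:
  "\<lbrakk>alg_le A c a; alg_le A c b; a \<in> carrier A; b \<in> carrier A; c \<in> carrier A\<rbrakk> \<Longrightarrow> alg_le A c (alg_meet A a b)"
  unfolding alg_le_def by (metis meet_assoc)

lemma le_meetI1: "\<lbrakk>alg_le A a c; a \<in> carrier A; b \<in> carrier A; c \<in> carrier A\<rbrakk> \<Longrightarrow> alg_le A (alg_meet A a b) c"
  by (rule le_trans[OF meet_le1]) (simp_all add: meet_closed)

lemma le_meetI2: "\<lbrakk>alg_le A b c; a \<in> carrier A; b \<in> carrier A; c \<in> carrier A\<rbrakk> \<Longrightarrow> alg_le A (alg_meet A a b) c"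
  by (rule le_trans[OF meet_le2]) (simp_all add: meet_closed)

lemma meet_mono: "\<lbrakk>alg_le A a c; alg_le A b d; a \<in> carrier A; b \<in> carrier A; c \<in> carrier A; d \<in> carrier A\<rbrakk>
  \<Longrightarrow> alg_le A (alg_meet A a b) (alg_meet A c d)"
  by (rule meet_greatest) (simp_all add: meet_closed le_meetI1 le_meetI2)

lemma le_iff_join: "\<lbrakk>a \<in> carrier A; b \<in> carrier A\<rbrakk> \<Longrightarrow> alg_le A a b \<longleftrightarrow> alg_join A a b = b"
  unfolding alg_le_def by (metis meet_absorb join_absorb meet_comm join_comm)

lemma join_ge1: "\<lbrakk>a \<in> carrier A; b \<in> carrier A\<rbrakk> \<Longrightarrow> alg_le A a (alg_join A a b)"
  by (simp add: alg_le_def meet_absorb)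

lemma join_ge2: "\<lbrakk>a \<in> carrier A; b \<in> carrier A\<rbrakk> \<Longrightarrow> alg_le A b (alg_join A a b)"
  by (metis join_ge1 join_comm)

lemma join_least:
  "\<lbrakk>alg_le A a c; alg_le A b c; a \<in> carrier A; b \<in> carrier A; c \<in> carrier A\<rbrakk> \<Longrightarrow> alg_le A (alg_join A a b) c"
  by (metis le_iff_join join_assoc join_closed)

lemmas closed = meet_closed join_closed imp_closed bot_closed top_closed

lemma imp_meet_le: "\<lbrakk>a \<in> carrier A; b \<in> carrier A\<rbrakk> \<Longrightarrow> alg_le A (alg_meet A (alg_imp A a b) a) b"
  using residuation le_refl closed by simp

lemma le_impI:
  "\<lbrakk>alg_le A (alg_meet A a b) c; a \<in> carrier A; b \<in> carrier A; c \<in> carrier A\<rbrakk> \<Longrightarrow> alg_le A a (alg_imp A b c)"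
  using residuation by simp

lemma top_meet: "a \<in> carrier A \<Longrightarrow> alg_meet A (alg_top A) a = a"
  by (metis alg_le_def meet_comm top_closed top_greatest)

lemma imp_eq_top: "\<lbrakk>a \<in> carrier A; b \<in> carrier A\<rbrakk> \<Longrightarrow> alg_imp A a b = alg_top A \<longleftrightarrow> alg_le A a b"
  by (metis imp_closed le_antisym residuation top_closed top_greatest top_meet le_refl)

definition filt :: "'a set \<Rightarrow> bool" where
  "filt F \<longleftrightarrow> F \<subseteq> carrier A \<and> alg_top A \<in> F \<and>
     (\<forall>x\<in>F. \<forall>y\<in>F. alg_meet A x y \<in> F) \<and> (\<forall>x\<in>F. \<forall>y\<in>carrier A. alg_le A x y \<longrightarrow> y \<in> F)"

definition prime_filt :: "'a set \<Rightarrow> bool" where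
  "prime_filt F \<longleftrightarrow> filt F \<and> alg_bot A \<notin> F \<and>
     (\<forall>x\<in>carrier A. \<forall>y\<in>carrier A. alg_join A x y \<in> F \<longrightarrow> x \<in> F \<or> y \<in> F)"

lemma filtD:
  assumes "filt F"
  shows "x \<in> F \<Longrightarrow> x \<in> carrier A" "alg_top A \<in> F"
    "\<lbrakk>x \<in> F; y \<in> F\<rbrakk> \<Longrightarrow> alg_meet A x y \<in> F"
    "\<lbrakk>x \<in> F; y \<in> carrier A; alg_le A x y\<rbrakk> \<Longrightarrow> y \<in> F"
  using assms unfolding filt_def by blast+

lemma prime_filtD:
  assumes "prime_filt F"
  shows "filt F" "alg_bot A \<notin> F"
    "\<lbrakk>alg_join A x y \<in> F; x \<in> carrier A; y \<in> carrier A\<rbrakk> \<Longrightarrow> x \<in> F \<or> y \<in> F"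
  using assms unfolding prime_filt_def by blast+

lemma filt_mp: "\<lbrakk>filt F; x \<in> F; alg_imp A x y \<in> F; y \<in> carrier A\<rbrakk> \<Longrightarrow> y \<in> F"
  by (meson filtD imp_meet_le)

lemma filt_impI:
  "\<lbrakk>filt F; x \<in> F; alg_le A (alg_meet A x b) c; b \<in> carrier A; c \<in> carrier A\<rbrakk> \<Longrightarrow> alg_imp A b c \<in> F"
  by (meson filtD le_impI imp_closed)

lemma filt_imp_le: "\<lbrakk>filt F; alg_le A b c; b \<in> carrier A; c \<in> carrier A\<rbrakk> \<Longrightarrow> alg_imp A b c \<in> F"
  using filtD(2) imp_eq_top by metis

lemma filt_imp_right: "\<lbrakk>filt F; c \<in> F; b \<in> carrier A\<rbrakk> \<Longrightarrow> alg_imp A b c \<in> F"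
  by (meson filtD filt_impI meet_le1)

lemma filt_imp_trans:
  assumes F: "filt F" and "alg_imp A a b \<in> F" "alg_imp A b c \<in> F"
    and [simp]: "a \<in> carrier A" "b \<in> carrier A" "c \<in> carrier A"
  shows "alg_imp A a c \<in> F"
proof (rule filt_impI[OF F filtD(3)[OF F assms(2,3)]])
  let ?x = "alg_imp A a b" and ?y = "alg_imp A b c"
  let ?m = "alg_meet A (alg_meet A ?x ?y) a"
  note [simp] = closed
  have x: "alg_le A ?m ?x" and y: "alg_le A ?m ?y" and a: "alg_le A ?m a"
    by (simp_all add: le_meetI1 le_meetI2 le_refl)
  have b: "alg_le A ?m b"
    by (rule le_trans[OF meet_greatest[OF x a] imp_meet_le]) simp_all
  show "alg_le A ?m c"
    by (rule le_trans[OF meet_greatest[OF y b] imp_meet_le]) simp_all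
qed auto

text \<open>Distributivity enters only through residuation: \<open>x \<and> b \<le> j\<close> and \<open>x \<and> c \<le> j\<close> give
  \<open>b \<or> c \<le> x \<rightarrow> j\<close>.\<close>
lemma prime_filter_exists:
  assumes F: "filt F" and J: "J \<subseteq> carrier A" "alg_bot A \<in> J"
    "\<And>x y. \<lbrakk>x \<in> J; y \<in> J\<rbrakk> \<Longrightarrow> alg_join A x y \<in> J"
    "\<And>x y. \<lbrakk>x \<in> J; y \<in> carrier A; alg_le A y x\<rbrakk> \<Longrightarrow> y \<in> J"
    and disj: "F \<inter> J = {}"
  obtains G where "prime_filt G" "F \<subseteq> G" "G \<inter> J = {}"
proof -
  note [simp] = closed
  let ?\<A> = "{G. filt G \<and> F \<subseteq> G \<and> G \<inter> J = {}}"
  have "\<exists>M\<in>?\<A>. \<forall>X\<in>?\<A>. M \<subseteq> X \<longrightarrow> X = M"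
  proof (rule subset_Zorn_nonempty)
    show "?\<A> \<noteq> {}" using F disj by blast
  next
    fix \<C> assume ne: "\<C> \<noteq> {}" and ch: "subset.chain ?\<A> \<C>"
    have mem: "filt G" "F \<subseteq> G" "G \<inter> J = {}" if "G \<in> \<C>" for G
      using ch that by (auto simp: subset_chain_def)
    have cmp: "G \<subseteq> G' \<or> G' \<subseteq> G" if "G \<in> \<C>" "G' \<in> \<C>" for G G'
      using ch that by (auto simp: subset_chain_def)
    have "alg_meet A x y \<in> \<Union>\<C>" if "x \<in> \<Union>\<C>" "y \<in> \<Union>\<C>" for x y
    proof -
      obtain G G' where "G \<in> \<C>" "G' \<in> \<C>" "x \<in> G" "y \<in> G'" using \<open>x \<in> \<Union>\<C>\<close> \<open>y \<in> \<Union>\<C>\<close> by blast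
      then obtain G'' where "G'' \<in> \<C>" "x \<in> G''" "y \<in> G''" using cmp[of G G'] by blast
      then show ?thesis using filtD(3)[OF mem(1)] by blast
    qed
    moreover have "alg_top A \<in> \<Union>\<C>" using ne filtD(2)[OF mem(1)] by blast
    moreover have "\<Union>\<C> \<subseteq> carrier A" using filtD(1)[OF mem(1)] by blast
    moreover have "y \<in> \<Union>\<C>" if "x \<in> \<Union>\<C>" "y \<in> carrier A" "alg_le A x y" for x y
      using that filtD(4)[OF mem(1)] by blast
    ultimately have "filt (\<Union>\<C>)"
      unfolding filt_def by blast
    then show "\<Union>\<C> \<in> ?\<A>" using ne mem(2,3) by blast
  qed
  then obtain G where G': "G \<in> ?\<A>" "\<forall>X\<in>?\<A>. G \<subseteq> X \<longrightarrow> X = G" by blast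
  have G: "filt G" "F \<subseteq> G" "G \<inter> J = {}" using G'(1) by blast+
  have max: "X = G" if "filt X" "F \<subseteq> X" "X \<inter> J = {}" "G \<subseteq> X" for X
    using G'(2) that by blast
  \<comment> \<open>Otherwise the filter generated by \<open>G\<close> and b would be a larger
    candidate, against maximality.\<close>
  have hit: "\<exists>g\<in>G. alg_meet A g b \<in> J" if b: "b \<in> carrier A" "b \<notin> G" for b
  proof (rule ccontr)
    assume no: "\<not> ?thesis"
    let ?X = "{x \<in> carrier A. \<exists>g\<in>G. alg_le A (alg_meet A g b) x}"
    have "filt ?X" unfolding filt_def
    proof (intro conjI ballI impI)
      show "alg_top A \<in> ?X" using filtD(2)[OF G(1)] b top_greatest[of "alg_meet A (alg_top A) b"] by auto
    next
      fix x y assume "x \<in> ?X" "y \<in> ?X"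
      then obtain g g' where g: "g \<in> G" "g' \<in> G" "alg_le A (alg_meet A g b) x"
        "alg_le A (alg_meet A g' b) y" and [simp]: "x \<in> carrier A" "y \<in> carrier A" by blast
      have [simp]: "g \<in> carrier A" "g' \<in> carrier A" "b \<in> carrier A"
        using g b filtD(1)[OF G(1)] by auto
      let ?m = "alg_meet A (alg_meet A g g') b"
      have "alg_le A ?m (alg_meet A g b)" "alg_le A ?m (alg_meet A g' b)"
        by (simp_all add: meet_mono meet_le1 meet_le2 le_refl)
      then have "alg_le A ?m x" "alg_le A ?m y"
        by - (rule le_trans[OF _ g(3)] le_trans[OF _ g(4)]; simp)+
      then have "alg_le A ?m (alg_meet A x y)" by (simp add: meet_greatest)
      moreover have "alg_meet A g g' \<in> G" using g filtD(3)[OF G(1)] by blast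
      ultimately show "alg_meet A x y \<in> ?X" by auto
    next
      fix x y assume x: "x \<in> ?X" and y: "y \<in> carrier A" "alg_le A x y"
      then obtain g where g: "g \<in> G" "alg_le A (alg_meet A g b) x" "x \<in> carrier A" by blast
      then have "alg_le A (alg_meet A g b) y"
        using le_trans[OF g(2) y(2)] filtD(1)[OF G(1)] b y by simp
      then show "y \<in> ?X" using g y by blast
    qed blast
    moreover have GX: "G \<subseteq> ?X"
    proof
      fix g assume "g \<in> G"
      then show "g \<in> ?X" using filtD(1)[OF G(1)] meet_le1[of g b] b by blast
    qed
    moreover have "?X \<inter> J = {}"
    proof -
      have "alg_meet A g b \<in> J" if "x \<in> J" "g \<in> G" "alg_le A (alg_meet A g b) x" for x g
        using J(4)[OF that(1) _ that(3)] filtD(1)[OF G(1) that(2)] b by simp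
      then show ?thesis using no by blast
    qed
    ultimately have "?X = G" using max G(2) by blast
    moreover have "b \<in> ?X"
      using filtD(2)[OF G(1)] meet_le2[OF top_closed b(1)] b(1) by blast
    ultimately show False using b by blast
  qed
  have "b \<in> G \<or> c \<in> G" if bc: "alg_join A b c \<in> G" and car[simp]: "b \<in> carrier A" "c \<in> carrier A" for b c
  proof (rule ccontr)
    assume "\<not> ?thesis"
    then obtain g h where g: "g \<in> G" "alg_meet A g b \<in> J" and h: "h \<in> G" "alg_meet A h c \<in> J"
      using hit[OF car(1)] hit[OF car(2)] by blast
    have [simp]: "g \<in> carrier A" "h \<in> carrier A" using g h filtD(1)[OF G(1)] by auto
    define x where "x = alg_meet A g h"
    define j where "j = alg_join A (alg_meet A g b) (alg_meet A h c)"
    have [simp]: "x \<in> carrier A" "j \<in> carrier A" by (simp_all add: x_def j_def)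
    have x: "x \<in> G" using g h filtD(3)[OF G(1)] by (simp add: x_def)
    have j: "j \<in> J" using g h J(3) by (simp add: j_def)
    have "alg_le A x g" "alg_le A x h" by (simp_all add: x_def meet_le1 meet_le2)
    then have "alg_le A (alg_meet A b x) (alg_meet A g b)" "alg_le A (alg_meet A c x) (alg_meet A h c)"
      by (simp_all add: meet_greatest le_meetI2 meet_le1)
    then have "alg_le A (alg_meet A b x) j" "alg_le A (alg_meet A c x) j"
      unfolding j_def
      by - (rule le_trans[OF _ join_ge1] le_trans[OF _ join_ge2]; simp)+
    then have "alg_le A b (alg_imp A x j)" "alg_le A c (alg_imp A x j)"
      by (simp_all add: residuation)
    then have "alg_le A (alg_join A b c) (alg_imp A x j)"
      by (simp add: join_least)
    then have "alg_imp A x j \<in> G" using bc filtD(4)[OF G(1)] by simp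
    then have "j \<in> G" using filt_mp[OF G(1) x] by simp
    then show False using j G(3) by blast
  qed
  moreover have "alg_bot A \<notin> G" using J(2) G(3) by blast
  ultimately have "prime_filt G" using G(1) by (simp add: prime_filt_def)
  then show ?thesis using that G by blast
qed

end

section \<open>Linearity of the quotient by a prime filter\<close>

context godel_algebra
begin

lemma prime_filt_linear:
  "\<lbrakk>prime_filt M; b \<in> carrier A; c \<in> carrier A\<rbrakk> \<Longrightarrow> alg_imp A b c \<in> M \<or> alg_imp A c b \<in> M"
  by (metis prime_filtD filtD(2) prelinearity imp_closed)

text \<open>If b were below b \<rightarrow> c, then b \<and> b \<le> c would hold. So by linearity b
  \<rightarrow> c is below b, and modus ponens gives (b \<rightarrow> c) \<and> b \<le> c.\<close>

lemma prime_filt_imp_imp: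
  assumes M: "prime_filt M" and [simp]: "b \<in> carrier A" "c \<in> carrier A" and no: "alg_imp A b c \<notin> M"
  shows "alg_imp A (alg_imp A b c) c \<in> M"
proof -
  note [simp] = closed
  note F = prime_filtD(1)[OF M]
  let ?i = "alg_imp A b c"
  have "alg_imp A b ?i \<notin> M"
  proof
    assume *: "alg_imp A b ?i \<in> M"
    let ?m = "alg_meet A (alg_imp A b ?i) b"
    have "alg_le A ?m (alg_meet A ?i b)"
      by (simp add: meet_greatest meet_le2 imp_meet_le)
    then have "alg_le A ?m c"
      by (rule le_trans[OF _ imp_meet_le]) simp_all
    then show False using filt_impI[OF F *] no by simp
  qed
  then have *: "alg_imp A ?i b \<in> M" using prime_filt_linear[OF M, of b ?i] by simp
  let ?m = "alg_meet A (alg_imp A ?i b) ?i"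
  have "alg_le A ?m (alg_meet A ?i b)"
    by (simp add: meet_greatest meet_le2 imp_meet_le)
  then have "alg_le A ?m c"
    by (rule le_trans[OF _ imp_meet_le]) simp_all
  then show ?thesis using filt_impI[OF F *] by simp
qed

lemma filt_le_meet:
  assumes F: "filt F" and "alg_imp A b c \<in> F" and [simp]: "b \<in> carrier A" "c \<in> carrier A"
  shows "alg_imp A b (alg_meet A b c) \<in> F"
  by (rule filt_impI[OF F assms(2)]) (simp_all add: closed meet_greatest meet_le2 imp_meet_le)

lemma filt_join_le:
  assumes F: "filt F" and b: "alg_imp A b d \<in> F" and c: "alg_imp A c d \<in> F"
    and [simp]: "b \<in> carrier A" "c \<in> carrier A" "d \<in> carrier A"
  shows "alg_imp A (alg_join A b c) d \<in> F"
proof (rule filt_impI[OF F filtD(3)[OF F b c]])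
  note [simp] = closed
  let ?b = "alg_imp A b d" and ?c = "alg_imp A c d"
  let ?x = "alg_meet A ?b ?c"
  have "alg_le A (alg_meet A b ?x) (alg_meet A ?b b)"
    by (simp add: meet_greatest le_meetI2 meet_le1)
  then have "alg_le A (alg_meet A b ?x) d"
    by (rule le_trans[OF _ imp_meet_le]) simp_all
  moreover have "alg_le A (alg_meet A c ?x) (alg_meet A ?c c)"
    by (simp add: meet_greatest le_meetI2 meet_le1 meet_le2)
  then have "alg_le A (alg_meet A c ?x) d"
    by (rule le_trans[OF _ imp_meet_le]) simp_all
  ultimately have "alg_le A (alg_join A b c) (alg_imp A ?x d)"
    by (simp add: join_least residuation)
  then have "alg_le A (alg_meet A (alg_join A b c) ?x) d"
    by (simp add: residuation)
  then show "alg_le A (alg_meet A ?x (alg_join A b c)) d"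
    by (simp add: meet_comm)
qed (simp_all add: closed)

text \<open>A prime filter makes the quotient a chain, so an order embedding of that chain into
  \<open>[0,1]\<close> respects all operations.\<close>
lemma chain_hom:
  fixes g :: "'a \<Rightarrow> real"
  assumes M: "prime_filt M"
    and g: "\<And>b c. \<lbrakk>b \<in> carrier A; c \<in> carrier A\<rbrakk> \<Longrightarrow> g b \<le> g c \<longleftrightarrow> alg_imp A b c \<in> M"
    and top: "g (alg_top A) = 1"
    and [simp]: "b \<in> carrier A" "c \<in> carrier A"
  shows "g (alg_meet A b c) = min (g b) (g c)"
    and "g (alg_join A b c) = max (g b) (g c)"
    and "g (alg_imp A b c) = godel_imp (g b) (g c)"
proof -
  note [simp] = closed
  note F = prime_filtD(1)[OF M]
  have meet: "g (alg_meet A b c) = g b" if "g b \<le> g c" "b \<in> carrier A" "c \<in> carrier A" for b c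
    using that filt_le_meet[OF F, of b c] filt_imp_le[OF F meet_le1, of b c]
    by (simp add: g antisym)
  have join: "g (alg_join A b c) = g c" if le: "g b \<le> g c" and [simp]: "b \<in> carrier A" "c \<in> carrier A" for b c
  proof (rule antisym)
    show "g c \<le> g (alg_join A b c)" using filt_imp_le[OF F join_ge2, of b c] by (simp add: g)
    show "g (alg_join A b c) \<le> g c"
      using le filt_join_le[OF F, of b c c] filt_imp_le[OF F le_refl, of c] by (simp add: g)
  qed
  show "g (alg_meet A b c) = min (g b) (g c)"
    using meet[of b c] meet[of c b] meet_comm[of b c] by (cases "g b \<le> g c") simp_all
  show "g (alg_join A b c) = max (g b) (g c)"
    using join[of b c] join[of c b] join_comm[of b c] by (cases "g b \<le> g c") simp_all
  show "g (alg_imp A b c) = godel_imp (g b) (g c)"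
  proof (cases "alg_imp A b c \<in> M")
    case True
    have "g (alg_top A) \<le> g (alg_imp A b c)"
      using filt_imp_right[OF F True, of "alg_top A"] by (simp add: g)
    moreover have "g (alg_imp A b c) \<le> g (alg_top A)"
      using filt_imp_le[OF F top_greatest, of "alg_imp A b c"] by (simp add: g)
    ultimately show ?thesis using True by (simp add: godel_imp_def g top)
  next
    case False
    have le: "g (alg_imp A b c) \<le> g c" using prime_filt_imp_imp[OF M _ _ False] by (simp add: g)
    have "alg_le A c (alg_imp A b c)" by (simp add: le_impI meet_le1)
    then have "g c \<le> g (alg_imp A b c)" using filt_imp_le[OF F] by (simp add: g)
    with le have "g (alg_imp A b c) = g c" by (rule antisym)
    then show ?thesis using False by (simp add: godel_imp_def g)
  qed
qed

end

section \<open>Successors of a prime filter\<close>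

context bimodal_godel_algebra
begin

lemma box_mono: "\<lbrakk>alg_le A a b; a \<in> carrier A; b \<in> carrier A\<rbrakk> \<Longrightarrow> alg_le A (alg_box A a) (alg_box A b)"
  by (metis alg_le_def box_meet)

lemma dia_mono: "\<lbrakk>alg_le A a b; a \<in> carrier A; b \<in> carrier A\<rbrakk> \<Longrightarrow> alg_le A (alg_dia A a) (alg_dia A b)"
  by (metis dia_closed le_iff_join dia_join)

lemmas modal_closed = closed box_closed dia_closed

text \<open>Separates the filter generated by p and all c with \<box>c \<in> F from the ideal
  generated by q and all k with \<diamond>k \<notin> F; \<open>sep\<close> is their disjointness.
  One c and one k suffice in \<open>sep\<close>, because I preserves meets, K preserves joins and
  \<open>F\<close> is prime.\<close>

lemma successor_filter:
  assumes F: "prime_filt F" and [simp]: "p \<in> carrier A" "q \<in> carrier A"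
    and sep: "\<And>c k. \<lbrakk>c \<in> carrier A; k \<in> carrier A; alg_box A c \<in> F; alg_dia A k \<notin> F;
        alg_le A (alg_meet A p c) (alg_join A q k)\<rbrakk> \<Longrightarrow> False"
  obtains G where "prime_filt G" "p \<in> G" "q \<notin> G"
    "\<And>b. \<lbrakk>b \<in> carrier A; alg_box A b \<in> F\<rbrakk> \<Longrightarrow> b \<in> G" "\<And>b. b \<in> G \<Longrightarrow> alg_dia A b \<in> F"
proof -
  note [simp] = modal_closed
  note fF = prime_filtD(1)[OF F]
  let ?X = "{x \<in> carrier A. \<exists>c\<in>carrier A. alg_box A c \<in> F \<and> alg_le A (alg_meet A p c) x}"
  let ?J = "{x \<in> carrier A. \<exists>k\<in>carrier A. alg_dia A k \<notin> F \<and> alg_le A x (alg_join A q k)}"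
  have box_top': "alg_box A (alg_top A) \<in> F" using filtD(2)[OF fF] by (simp add: box_top)
  have dia_bot': "alg_dia A (alg_bot A) \<notin> F" using prime_filtD(2)[OF F] by (simp add: dia_bot)
  have "filt ?X" unfolding filt_def
  proof (intro conjI ballI impI)
    show "alg_top A \<in> ?X"
      using box_top' top_greatest[of "alg_meet A p (alg_top A)"] by auto
  next
    fix x y assume "x \<in> ?X" "y \<in> ?X"
    then obtain c d where c: "alg_box A c \<in> F" "alg_box A d \<in> F" "alg_le A (alg_meet A p c) x"
      "alg_le A (alg_meet A p d) y" and [simp]: "x \<in> carrier A" "y \<in> carrier A" "c \<in> carrier A" "d \<in> carrier A"
      by blast
    let ?m = "alg_meet A p (alg_meet A c d)"
    have "alg_le A ?m (alg_meet A p c)" "alg_le A ?m (alg_meet A p d)"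
      by (simp_all add: meet_mono meet_le1 meet_le2 le_refl)
    then have "alg_le A ?m x" "alg_le A ?m y"
      by - (rule le_trans[OF _ c(3)] le_trans[OF _ c(4)]; simp)+
    then have "alg_le A ?m (alg_meet A x y)" by (simp add: meet_greatest)
    moreover have "alg_box A (alg_meet A c d) \<in> F" using c filtD(3)[OF fF] by (simp add: box_meet)
    moreover have "alg_meet A c d \<in> carrier A" "alg_meet A x y \<in> carrier A" by simp_all
    ultimately show "alg_meet A x y \<in> ?X" by blast
  next
    fix x y assume x: "x \<in> ?X" and y: "y \<in> carrier A" "alg_le A x y"
    then obtain c where c: "c \<in> carrier A" "alg_box A c \<in> F" "alg_le A (alg_meet A p c) x" "x \<in> carrier A" by blast
    then have "alg_le A (alg_meet A p c) y" using le_trans[OF c(3) y(2)] y by simp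
    then show "y \<in> ?X" using c y by blast
  qed blast
  moreover have "?J \<subseteq> carrier A" by blast
  moreover have "alg_bot A \<in> ?J" using dia_bot' bot_least[of "alg_join A q (alg_bot A)"] by auto
  moreover have "alg_join A x y \<in> ?J" if xy: "x \<in> ?J" "y \<in> ?J" for x y
  proof -
    obtain c d where c: "alg_dia A c \<notin> F" "alg_dia A d \<notin> F" "alg_le A x (alg_join A q c)"
      "alg_le A y (alg_join A q d)" and [simp]: "x \<in> carrier A" "y \<in> carrier A" "c \<in> carrier A" "d \<in> carrier A"
      using xy by blast
    let ?m = "alg_join A q (alg_join A c d)"
    have "alg_le A c ?m" "alg_le A d ?m"
      by (rule le_trans[OF _ join_ge2]; simp add: join_ge1 join_ge2)+
    then have "alg_le A (alg_join A q c) ?m" "alg_le A (alg_join A q d) ?m"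
      by (simp_all add: join_least join_ge1)
    then have "alg_le A x ?m" "alg_le A y ?m"
      by - (rule le_trans[OF c(3)] le_trans[OF c(4)]; simp)+
    then have "alg_le A (alg_join A x y) ?m" by (simp add: join_least)
    moreover have "alg_dia A (alg_join A c d) \<notin> F"
      using c prime_filtD(3)[OF F, of "alg_dia A c" "alg_dia A d"] by (auto simp: dia_join)
    moreover have "alg_join A c d \<in> carrier A" "alg_join A x y \<in> carrier A" by simp_all
    ultimately show ?thesis by blast
  qed
  moreover have "y \<in> ?J" if x: "x \<in> ?J" and y: "y \<in> carrier A" "alg_le A y x" for x y
  proof -
    obtain c where c: "c \<in> carrier A" "alg_dia A c \<notin> F" "alg_le A x (alg_join A q c)" "x \<in> carrier A"
      using x by blast
    then have "alg_le A y (alg_join A q c)" using le_trans[OF y(2) c(3)] y by simp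
    then show ?thesis using c y by blast
  qed
  moreover have "?X \<inter> ?J = {}"
  proof -
    have False if c: "c \<in> carrier A" "alg_box A c \<in> F" "alg_le A (alg_meet A p c) x" "x \<in> carrier A"
      and k: "k \<in> carrier A" "alg_dia A k \<notin> F" "alg_le A x (alg_join A q k)" for x c k
      using sep[of c k] le_trans[OF c(3) k(3)] c k by simp
    then show ?thesis by blast
  qed
  ultimately obtain G where G: "prime_filt G" "?X \<subseteq> G" "G \<inter> ?J = {}"
    using prime_filter_exists[of ?X ?J] by blast
  show ?thesis
  proof
    show "prime_filt G" by fact
    have "p \<in> ?X" using box_top' meet_le1[of p "alg_top A"] by auto
    then show "p \<in> G" using G by blast
    have "q \<in> ?J" using dia_bot' join_ge1[of q "alg_bot A"] by auto
    then show "q \<notin> G" using G by blast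
    show "b \<in> G" if "b \<in> carrier A" "alg_box A b \<in> F" for b
      using G(2) that meet_le2[of p b] by auto
    show "alg_dia A b \<in> F" if "b \<in> G" for b
    proof (rule ccontr)
      have [simp]: "b \<in> carrier A" using that G(1) prime_filtD filtD by blast
      assume "alg_dia A b \<notin> F"
      then have "b \<in> ?J" using join_ge2[of q b] by auto
      then show False using G(3) that by blast
    qed
  qed
qed

text \<open>\<open>F\<close> is the open cut strictly above \<box>a in A/M, so \<box>a itself stays
  outside. Separation: \<diamond>k \<notin> F says \<diamond>k \<le> \<box>a, whence \<box>(k
  \<rightarrow> a) \<in> M. If c \<le> a \<or> k, then (k \<rightarrow> a) \<and> c \<le> a, so
  \<box>c \<in> F would put \<box>a into \<open>F\<close>.\<close>

lemma box_successor:
  assumes M: "prime_filt M" and [simp]: "a \<in> carrier A" and a: "alg_box A a \<notin> M"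
  defines "F \<equiv> {x \<in> carrier A. alg_imp A x (alg_box A a) \<notin> M}"
  shows "\<exists>G. M \<subseteq> F \<and> prime_filt F \<and> prime_filt G \<and> a \<notin> G \<and>
    (\<forall>b\<in>carrier A. alg_box A b \<in> F \<longrightarrow> b \<in> G) \<and> (\<forall>b\<in>G. alg_dia A b \<in> F)"
proof -
  note [simp] = modal_closed
  note fM = prime_filtD(1)[OF M]
  have MF: "M \<subseteq> F"
  proof
    fix x assume "x \<in> M"
    then show "x \<in> F" using a filt_mp[OF fM, of x "alg_box A a"] filtD(1)[OF fM, of x] by (auto simp: F_def)
  qed
  have "filt F" unfolding filt_def
  proof (intro conjI ballI impI)
    show "alg_top A \<in> F" using MF filtD(2)[OF fM] by blast
    show "F \<subseteq> carrier A" by (auto simp: F_def)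
    fix x y assume x: "x \<in> F"
    then have [simp]: "x \<in> carrier A" by (simp add: F_def)
    { assume "y \<in> F"
      then have [simp]: "y \<in> carrier A" by (simp add: F_def)
      \<comment> \<open>In the chain A/M the meet equals x or y.\<close>
      have "alg_imp A (alg_meet A x y) (alg_box A a) \<notin> M"
        using x \<open>y \<in> F\<close> prime_filt_linear[OF M, of x y] filt_le_meet[OF fM, of x y]
          filt_le_meet[OF fM, of y x] filt_imp_trans[OF fM, of _ "alg_meet A x y" "alg_box A a"]
        by (auto simp: F_def meet_comm[of y x])
      then show "alg_meet A x y \<in> F" by (simp add: F_def) }
    { assume "y \<in> carrier A" "alg_le A x y"
      then show "y \<in> F"
        using x filt_imp_le[OF fM, of x y] filt_imp_trans[OF fM, of x y "alg_box A a"]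
        by (auto simp: F_def) }
  qed
  moreover have "alg_bot A \<notin> F"
    using filt_imp_le[OF fM bot_least, of "alg_box A a"] by (simp add: F_def)
  ultimately have F: "prime_filt F"
    unfolding prime_filt_def using filt_join_le[OF fM, of _ "alg_box A a"] by (auto simp: F_def)
  note fF = prime_filtD(1)[OF F]
  have sep: False if [simp]: "c \<in> carrier A" "k \<in> carrier A" and c: "alg_box A c \<in> F"
    and k: "alg_dia A k \<notin> F" and le: "alg_le A (alg_meet A (alg_top A) c) (alg_join A a k)" for c k
  proof -
    have "alg_imp A (alg_dia A k) (alg_box A a) \<in> M" using k by (simp add: F_def)
    then have "alg_box A (alg_imp A k a) \<in> M"
      using filtD(4)[OF fM _ _ dia_imp_box, of k a] by simp
    then have "alg_box A (alg_meet A (alg_imp A k a) c) \<in> F"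
      using filtD(3)[OF fF] MF c by (simp add: box_meet subset_iff)
    moreover have "alg_le A (alg_meet A (alg_imp A k a) c) a"
    proof -
      have c: "alg_le A c (alg_join A a k)" using le by (simp add: top_meet)
      have "alg_le A (alg_join A a k) (alg_imp A (alg_imp A k a) a)"
        by (rule join_least) (simp_all add: le_impI meet_le1 meet_comm[of k] imp_meet_le)
      then have "alg_le A c (alg_imp A (alg_imp A k a) a)"
        by (rule le_trans[OF c]) simp_all
      then show ?thesis by (simp add: residuation[symmetric] meet_comm[of _ c])
    qed
    then have "alg_le A (alg_box A (alg_meet A (alg_imp A k a) c)) (alg_box A a)"
      by (simp add: box_mono)
    ultimately have "alg_box A a \<in> F" using filtD(4)[OF fF] by simp
    then show False using filt_imp_le[OF fM le_refl, of "alg_box A a"] by (simp add: F_def)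
  qed
  obtain G where "prime_filt G" "a \<notin> G" "\<forall>b\<in>carrier A. alg_box A b \<in> F \<longrightarrow> b \<in> G" "\<forall>b\<in>G. alg_dia A b \<in> F"
    using successor_filter[OF F top_closed \<open>a \<in> carrier A\<close>] sep by metis
  then show ?thesis using MF F by blast
qed

text \<open>\<open>F\<close> is the closed cut at \<diamond>a, proper because \<diamond>a is not 0
  in A/M. Separation: a \<and> c \<le> k gives c \<le> a \<rightarrow> k, so \<box>c \<in> F yields
  \<box>(a \<rightarrow> k) \<in> F. Applying K to a \<le> (a \<rightarrow> k) \<rightarrow> k gives
  \<diamond>a \<le> \<box>(a \<rightarrow> k) \<rightarrow> \<diamond>k, which forces \<diamond>k
  \<in> F.\<close>

lemma dia_successor:
  assumes M: "prime_filt M" and [simp]: "a \<in> carrier A" and a: "alg_imp A (alg_dia A a) (alg_bot A) \<notin> M"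
  defines "F \<equiv> {x \<in> carrier A. alg_imp A (alg_dia A a) x \<in> M}"
  shows "\<exists>G. M \<subseteq> F \<and> prime_filt F \<and> prime_filt G \<and> a \<in> G \<and>
    (\<forall>b\<in>carrier A. alg_box A b \<in> F \<longrightarrow> b \<in> G) \<and> (\<forall>b\<in>G. alg_dia A b \<in> F)"
proof -
  note [simp] = modal_closed
  note fM = prime_filtD(1)[OF M]
  let ?d = "alg_dia A a"
  have MF: "M \<subseteq> F" using filt_imp_right[OF fM, of _ ?d] filtD(1)[OF fM] unfolding F_def by force
  have trans: "y \<in> F" if "x \<in> F" "alg_imp A x y \<in> M" "y \<in> carrier A" for x y
    using that filt_imp_trans[OF fM, of ?d x y] by (auto simp: F_def)
  have "filt F" unfolding filt_def
  proof (intro conjI ballI impI)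
    show "alg_top A \<in> F" using MF filtD(2)[OF fM] by blast
    show "F \<subseteq> carrier A" by (auto simp: F_def)
    fix x y assume x: "x \<in> F"
    then have [simp]: "x \<in> carrier A" by (simp add: F_def)
    { assume y: "y \<in> F"
      then have [simp]: "y \<in> carrier A" by (simp add: F_def)
      show "alg_meet A x y \<in> F"
        using trans[OF x] trans[OF y] prime_filt_linear[OF M, of x y] filt_le_meet[OF fM, of x y]
          filt_le_meet[OF fM, of y x]
        by (auto simp: meet_comm[of y x]) }
    { assume "y \<in> carrier A" "alg_le A x y"
      then show "y \<in> F" using trans[OF x] filt_imp_le[OF fM, of x y] by simp }
  qed
  moreover have "alg_bot A \<notin> F" using a by (simp add: F_def)
  moreover have "x \<in> F \<or> y \<in> F" if xy: "alg_join A x y \<in> F" and [simp]: "x \<in> carrier A" "y \<in> carrier A" for x y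
  proof -
    have "alg_imp A (alg_join A x y) y \<in> M \<or> alg_imp A (alg_join A x y) x \<in> M"
      using prime_filt_linear[OF M, of x y] filt_join_le[OF fM, of x y y] filt_join_le[OF fM, of x x y]
        filt_imp_le[OF fM le_refl] by auto
    then show ?thesis using trans[OF xy] by auto
  qed
  ultimately have F: "prime_filt F" unfolding prime_filt_def by blast
  note fF = prime_filtD(1)[OF F]
  have sep: False if [simp]: "c \<in> carrier A" "k \<in> carrier A" and c: "alg_box A c \<in> F"
    and k: "alg_dia A k \<notin> F" and le: "alg_le A (alg_meet A a c) (alg_join A (alg_bot A) k)" for c k
  proof -
    have "alg_join A (alg_bot A) k = k" using le_iff_join bot_least by simp
    then have le': "alg_le A c (alg_imp A a k)" using le by (simp add: residuation[symmetric] meet_comm[of c])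
    let ?i = "alg_imp A a k"
    have i: "alg_box A ?i \<in> F" using filtD(4)[OF fF c _ box_mono[OF le']] by simp
    have "alg_le A a (alg_imp A ?i k)" by (simp add: le_impI meet_comm[of a] imp_meet_le)
    then have "alg_le A ?d (alg_dia A (alg_imp A ?i k))" by (simp add: dia_mono)
    then have "alg_le A ?d (alg_imp A (alg_box A ?i) (alg_dia A k))"
      by (rule le_trans[OF _ dia_imp]) simp_all
    moreover have "?d \<in> F" using filt_imp_le[OF fM le_refl, of ?d] by (simp add: F_def)
    ultimately have "alg_imp A (alg_box A ?i) (alg_dia A k) \<in> F" using filtD(4)[OF fF] by simp
    then show False using filt_mp[OF fF i] k by simp
  qed
  obtain G where "prime_filt G" "a \<in> G" "\<forall>b\<in>carrier A. alg_box A b \<in> F \<longrightarrow> b \<in> G" "\<forall>b\<in>G. alg_dia A b \<in> F"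
    using successor_filter[OF F \<open>a \<in> carrier A\<close> bot_closed] sep by metis
  then show ?thesis using MF F by blast
qed

end

section \<open>Countable total preorders\<close>

definition total_preorder :: "'s set \<Rightarrow> ('s \<Rightarrow> 's \<Rightarrow> bool) \<Rightarrow> bool" where
  "total_preorder X R \<longleftrightarrow> (\<forall>x\<in>X. \<forall>y\<in>X. R x y \<or> R y x) \<and>
     (\<forall>x\<in>X. \<forall>y\<in>X. \<forall>z\<in>X. R x y \<longrightarrow> R y z \<longrightarrow> R x z)"

lemma total_preorderD:
  assumes "total_preorder X R"
  shows "\<lbrakk>x \<in> X; y \<in> X\<rbrakk> \<Longrightarrow> R x y \<or> R y x"
    and "\<lbrakk>R x y; R y z; x \<in> X; y \<in> X; z \<in> X\<rbrakk> \<Longrightarrow> R x z"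
    and "x \<in> X \<Longrightarrow> R x x"
  using assms unfolding total_preorder_def by blast+

text \<open>Here \<open>P x y\<close> prescribes \<open>x \<le> y\<close> and \<open>Q y x\<close> prescribes \<open>y \<le> x\<close>, for \<open>x\<close> in \<open>X\<close> and \<open>y\<close> in \<open>Y\<close>;
  the last two premises say that these prescriptions add no relation inside \<open>X\<close> or \<open>Y\<close>.
  Where they leave a choice, \<open>y\<close> is placed as low as possible.\<close>
lemma total_preorder_amalgam:
  assumes XY: "X \<inter> Y = {}" and R: "total_preorder X R" and E: "total_preorder Y E"
    and PX: "\<And>x x' y. \<lbrakk>R x x'; P x' y; x \<in> X; x' \<in> X; y \<in> Y\<rbrakk> \<Longrightarrow> P x y"
    and PY: "\<And>x y y'. \<lbrakk>P x y; E y y'; x \<in> X; y \<in> Y; y' \<in> Y\<rbrakk> \<Longrightarrow> P x y'"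
    and QX: "\<And>x x' y. \<lbrakk>Q y x; R x x'; x \<in> X; x' \<in> X; y \<in> Y\<rbrakk> \<Longrightarrow> Q y x'"
    and QY: "\<And>x y y'. \<lbrakk>E y y'; Q y' x; x \<in> X; y \<in> Y; y' \<in> Y\<rbrakk> \<Longrightarrow> Q y x"
    and PQ: "\<And>x x' y. \<lbrakk>P x y; Q y x'; x \<in> X; x' \<in> X; y \<in> Y\<rbrakk> \<Longrightarrow> R x x'"
    and QP: "\<And>x y y'. \<lbrakk>Q y x; P x y'; x \<in> X; y \<in> Y; y' \<in> Y\<rbrakk> \<Longrightarrow> E y y'"
  shows "\<exists>T. total_preorder (X \<union> Y) T \<and> (\<forall>x\<in>X. \<forall>x'\<in>X. T x x' \<longleftrightarrow> R x x') \<and>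
    (\<forall>y\<in>Y. \<forall>y'\<in>Y. T y y' \<longleftrightarrow> E y y') \<and> (\<forall>x\<in>X. \<forall>y\<in>Y. (P x y \<longrightarrow> T x y) \<and> (Q y x \<longrightarrow> T y x))"
proof -
  \<comment> \<open>A point of \<open>Y\<close> goes below a point of \<open>X\<close> by default;
    only \<open>P\<close> lifts it. Where \<open>P\<close> and \<open>Q\<close> both hold, the two
    points become equivalent.\<close>
  define T where "T = (\<lambda>u v. if u \<in> X then (if v \<in> X then R u v else P u v)
    else (if v \<in> X then \<not> P v u \<or> Q u v else E u v))"
  have Y: "y \<notin> X" if "y \<in> Y" for y using that XY by blast
  have XX: "T x x' \<longleftrightarrow> R x x'" if "x \<in> X" "x' \<in> X" for x x' using that by (simp add: T_def)
  have YY: "T y y' \<longleftrightarrow> E y y'" if "y \<in> Y" "y' \<in> Y" for y y' using that Y by (simp add: T_def)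
  have XY: "T x y \<longleftrightarrow> P x y" if "x \<in> X" "y \<in> Y" for x y using that Y by (simp add: T_def)
  have YX: "T y x \<longleftrightarrow> \<not> P x y \<or> Q y x" if "x \<in> X" "y \<in> Y" for x y using that Y by (simp add: T_def)
  note RD = total_preorderD[OF R] and ED = total_preorderD[OF E]
  have "T u v \<or> T v u" if "u \<in> X \<union> Y" "v \<in> X \<union> Y" for u v
    using that RD(1)[of u v] ED(1)[of u v] by (auto simp: XX XY YX YY)
  moreover have "T u w" if T: "T u v" "T v w" and mem: "u \<in> X \<union> Y" "v \<in> X \<union> Y" "w \<in> X \<union> Y" for u v w
  proof -
    consider "u \<in> X" "v \<in> X" "w \<in> X" | "u \<in> X" "v \<in> X" "w \<in> Y" | "u \<in> X" "v \<in> Y" "w \<in> X"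
      | "u \<in> X" "v \<in> Y" "w \<in> Y" | "u \<in> Y" "v \<in> X" "w \<in> X" | "u \<in> Y" "v \<in> X" "w \<in> Y"
      | "u \<in> Y" "v \<in> Y" "w \<in> X" | "u \<in> Y" "v \<in> Y" "w \<in> Y"
      using mem by blast
    then show ?thesis
    proof cases
      case 1 then show ?thesis using T RD(2)[of u v w] by (simp add: XX)
    next
      case 2 then show ?thesis using T PX[of u v w] by (simp add: XX XY)
    next
      case 3
      then have "P u v" "\<not> P w v \<or> Q v w" using T by (simp_all add: XY YX)
      then show ?thesis using 3 PQ[of u v w] PX[of w u v] RD(1)[of u w] by (auto simp: XX)
    next
      case 4 then show ?thesis using T PY[of u v w] by (simp add: XY YY)
    next
      case 5
      then have "\<not> P v u \<or> Q u v" "R v w" using T by (simp_all add: XX YX)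
      then show ?thesis using 5 PX[of v w u] QX[of u v w] by (auto simp: YX)
    next
      case 6
      then have "\<not> P v u \<or> Q u v" "P v w" using T by (simp_all add: XY YX)
      then show ?thesis using 6 QP[of u v w] PY[of v w u] ED(1)[of u w] by (auto simp: YY)
    next
      case 7
      then have "E u v" "\<not> P w v \<or> Q v w" using T by (simp_all add: YY YX)
      then show ?thesis using 7 PY[of w u v] QY[of u v w] by (auto simp: YX)
    next
      case 8 then show ?thesis using T ED(2)[of u v w] by (simp add: YY)
    qed
  qed
  ultimately have "total_preorder (X \<union> Y) T" unfolding total_preorder_def by blast
  then show ?thesis using XX XY YX YY by blast
qed
lemma total_preorder_minimum:
  assumes "total_preorder X R" "finite C" "C \<noteq> {}" "C \<subseteq> X"
  obtains c where "c \<in> C" "\<And>d. d \<in> C \<Longrightarrow> R c d"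
proof -
  have "\<exists>c\<in>C. \<forall>d\<in>C. R c d" using assms(2,3,4)
  proof (induction rule: finite_ne_induct)
    case (singleton x)
    then show ?case using total_preorderD(3)[OF assms(1)] by simp
  next
    case (insert x C)
    then obtain c where c: "c \<in> C" "\<forall>d\<in>C. R c d" by auto
    have "R x c \<or> R c x" using insert.prems c total_preorderD(1)[OF assms(1)] by blast
    then show ?case
    proof
      assume "R x c"
      have "R x d" if "d \<in> C" for d
        using that c insert.prems total_preorderD(2)[OF assms(1) \<open>R x c\<close>, of d] by blast
      then show ?thesis using insert.prems total_preorderD(3)[OF assms(1), of x] by blast
    next
      assume "R c x"
      then show ?thesis using c by blast
    qed
  qed
  then show ?thesis using that by blast
qed

text \<open>With \<open>f x = (\<Sum>n. [e n \<le> x] / 2 ^ n)\<close> for an enumeration \<open>e\<close>, the value \<open>f x\<close> is also the limit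
  of \<open>f y\<close> as \<open>y\<close> decreases to \<open>x\<close>: elements above \<open>x\<close> with small index can be avoided.\<close>
lemma total_preorder_embed_real:
  assumes R: "total_preorder X R" and "countable X"
    and bt: "b \<in> X" "t \<in> X" "\<not> R t b" and bot: "\<forall>x\<in>X. R b x" and top: "\<forall>x\<in>X. R x t"
  shows "\<exists>f :: 's \<Rightarrow> real. (\<forall>x\<in>X. f x \<in> {0..1}) \<and> (\<forall>x\<in>X. \<forall>y\<in>X. f x \<le> f y \<longleftrightarrow> R x y) \<and>
    f b = 0 \<and> f t = 1 \<and> (\<forall>x\<in>X. \<forall>\<epsilon>>0. \<not> R t x \<longrightarrow>
      (\<exists>c\<in>X. \<not> R c x \<and> (\<forall>y\<in>X. \<not> R c y \<longrightarrow> f y < f x + \<epsilon>)))"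
proof -
  note RD = total_preorderD[OF R]
  define e where "e = from_nat_into X"
  have e: "e n \<in> X" for n using bt by (auto simp: e_def intro: from_nat_into)
  have e_surj: "\<exists>n. e n = x" if "x \<in> X" for x
    using from_nat_into_surj[OF \<open>countable X\<close> that] by (simp add: e_def)
  define w where "w x n = (if R (e n) x then (1/2) ^ n else 0 :: real)" for x n
  define F where "F x = suminf (w x)" for x
  have w: "0 \<le> w x n" "w x n \<le> (1/2) ^ n" for x n by (simp_all add: w_def)
  have sg: "summable (\<lambda>n. (1/2) ^ n :: real)" by (simp add: summable_geometric)
  have sw: "summable (w x)" for x
    by (rule summable_comparison_test'[OF sg, of 0]) (simp add: w_def)
  have mono: "F x \<le> F y" if "R x y" "x \<in> X" "y \<in> X" for x y
    unfolding F_def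
    by (rule suminf_le[OF _ sw sw]) (use RD(2)[OF _ that(1) e that(2,3)] in \<open>auto simp: w_def\<close>)
  have strict: "F y < F x" if no: "\<not> R x y" and xy: "x \<in> X" "y \<in> X" for x y
  proof -
    obtain m where m: "e m = x" using e_surj xy by blast
    \<comment> \<open>The summand at the index of x itself makes the inequality strict.\<close>
    have "R y x" using RD(1) no xy by blast
    then have "w y n \<le> w x n" for n
      using RD(2)[OF _ _ e xy(2,1)] by (auto simp: w_def)
    moreover have "w y m < w x m" using no RD(3)[OF xy(1)] by (simp add: w_def m)
    ultimately have "0 < (\<Sum>n. w x n - w y n)"
      by (intro suminf_pos2[of _ m] summable_diff sw) auto
    then show ?thesis by (simp add: F_def suminf_diff[OF sw sw, symmetric])
  qed
  have iff: "F x \<le> F y \<longleftrightarrow> R x y" if "x \<in> X" "y \<in> X" for x y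
    using mono strict that by (metis linorder_not_le)
  have approx: "\<exists>c\<in>X. \<not> R c x \<and> (\<forall>y\<in>X. \<not> R c y \<longrightarrow> F y < F x + \<delta>)"
    if x: "x \<in> X" "\<not> R t x" and "\<delta> > 0" for x \<delta>
  proof -
    \<comment> \<open>The tail from index \<open>N\<close> on is at most twice (1/2)^N.\<close>
    obtain N where N: "(1/2 :: real) ^ N < \<delta> / 2"
      using real_arch_pow_inv[of "\<delta> / 2" "1/2"] \<open>\<delta> > 0\<close> by auto
    \<comment> \<open>The points above x with small index. Adding \<open>t\<close>, which is also
      above x, guarantees a minimum c; a y strictly below c can exceed x only in the tail of the
      series.\<close>
    define C where "C = insert t {c \<in> e ` {..<N}. \<not> R c x}"
    have "finite C" "C \<noteq> {}" "C \<subseteq> X" using e bt by (auto simp: C_def)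
    then obtain c where c: "c \<in> C" "\<And>d. d \<in> C \<Longrightarrow> R c d"
      using total_preorder_minimum[OF R] by metis
    have cX: "c \<in> X" "\<not> R c x" using c(1) x e bt by (auto simp: C_def)
    have "F y < F x + \<delta>" if y: "y \<in> X" "\<not> R c y" for y
    proof -
      have le: "w y n \<le> w x n" if "n < N" for n
      proof -
        have "R (e n) x" if ny: "R (e n) y"
        proof (rule ccontr)
          assume "\<not> R (e n) x"
          then have "R c (e n)" using c(2) \<open>n < N\<close> by (simp add: C_def)
          then show False using RD(2)[OF _ ny cX(1) e y(1)] y(2) by blast
        qed
        then show ?thesis by (auto simp: w_def)
      qed
      have "(\<Sum>n. w y (n + N)) \<le> (\<Sum>n. (1/2) ^ (n + N))"
        by (rule suminf_le) (use w sw sg in \<open>auto simp: summable_iff_shift\<close>)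
      also have "\<dots> = (\<Sum>n. (1/2) ^ n * (1/2) ^ N)" by (simp add: power_add)
      also have "\<dots> = 2 * (1/2 :: real) ^ N"
        using suminf_mult2[OF sg, of "(1/2) ^ N"] suminf_geometric[of "1/2 :: real"] by simp
      also have "\<dots> < \<delta>" using N by simp
      finally have tail: "(\<Sum>n. w y (n + N)) < \<delta>" .
      have "F y = (\<Sum>n. w y (n + N)) + (\<Sum>n<N. w y n)"
        unfolding F_def by (rule suminf_split_initial_segment[OF sw])
      moreover have "(\<Sum>n<N. w y n) \<le> (\<Sum>n<N. w x n)" by (rule sum_mono) (use le in auto)
      moreover have "(\<Sum>n<N. w x n) \<le> F x"
        unfolding F_def by (rule sum_le_suminf[OF sw]) (use w in auto)
      ultimately show ?thesis using tail by linarith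
    qed
    then show ?thesis using cX by blast
  qed
  define d where "d = F t - F b"
  have d: "d > 0" using strict[OF bt(3,2,1)] by (simp add: d_def)
  define f where "f x = (F x - F b) / d" for x
  show ?thesis
  proof (intro exI[of _ f] conjI ballI allI impI)
    show "f x \<in> {0..1}" if "x \<in> X" for x
      using d mono[OF bspec[OF bot that] bt(1) that] mono[OF bspec[OF top that] that bt(2)] by (simp add: f_def d_def)
    show "f x \<le> f y \<longleftrightarrow> R x y" if "x \<in> X" "y \<in> X" for x y
      using d iff[OF that] by (simp add: f_def divide_le_cancel)
    show "f b = 0" "f t = 1" using d by (simp_all add: f_def d_def)
    show "\<exists>c\<in>X. \<not> R c x \<and> (\<forall>y\<in>X. \<not> R c y \<longrightarrow> f y < f x + \<epsilon>)"
      if x: "x \<in> X" "\<epsilon> > 0" "\<not> R t x" for x \<epsilon>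
    proof -
      have *: "f y < f x + \<epsilon>" if "F y < F x + \<epsilon> * d" for y
        using that d by (simp add: f_def field_simps)
      obtain c where "c \<in> X" "\<not> R c x" "\<forall>y\<in>X. \<not> R c y \<longrightarrow> F y < F x + \<epsilon> * d"
        using approx[of x "\<epsilon> * d"] x d by auto
      then show ?thesis using * by blast
    qed
  qed
qed

section \<open>The frame of a saturated set of valuations\<close>

context bimodal_godel_algebra
begin

definition godel_hom :: "('a \<Rightarrow> real) \<Rightarrow> bool" where
  "godel_hom w \<longleftrightarrow> (\<forall>a\<in>carrier A. w a \<in> {0..1}) \<and> w (alg_bot A) = 0 \<and> w (alg_top A) = 1 \<and>
     (\<forall>a\<in>carrier A. \<forall>b\<in>carrier A. w (alg_meet A a b) = min (w a) (w b) \<and>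
        w (alg_join A a b) = max (w a) (w b) \<and> w (alg_imp A a b) = godel_imp (w a) (w b))"

definition acc :: "('a \<Rightarrow> real) \<Rightarrow> ('a \<Rightarrow> real) \<Rightarrow> real" where
  "acc v w = (INF b\<in>carrier A. min (godel_imp (v (alg_box A b)) (w b)) (godel_imp (w b) (v (alg_dia A b))))"

text \<open>Stronger than s \<le> \<open>acc v w\<close>: the bound from \<box> holds outright, and
  only the bound from \<diamond> may fail, at values that are at least s. This is what the
  construction delivers.\<close>

definition acc_ge :: "real \<Rightarrow> ('a \<Rightarrow> real) \<Rightarrow> ('a \<Rightarrow> real) \<Rightarrow> bool" where
  "acc_ge s v w \<longleftrightarrow> (\<forall>b\<in>carrier A. v (alg_box A b) \<le> w b \<and>
     (w b \<le> v (alg_dia A b) \<or> s \<le> v (alg_dia A b)))"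

text \<open>Witnesses for \<open>v (\<box>a)\<close> only approximate the infimum: in general it is not attained,
  whereas the supremum for \<open>v (\<diamond>a)\<close> can always be attained.\<close>
definition saturated :: "('a \<Rightarrow> real) set \<Rightarrow> bool" where
  "saturated W \<longleftrightarrow> (\<forall>w\<in>W. godel_hom w) \<and>
     (\<forall>v\<in>W. \<forall>a\<in>carrier A. \<forall>\<epsilon>>0. v (alg_box A a) < 1 \<longrightarrow>
        (\<exists>w\<in>W. \<exists>s\<le>1. w a < s \<and> w a < v (alg_box A a) + \<epsilon> \<and> acc_ge s v w)) \<and>
     (\<forall>v\<in>W. \<forall>a\<in>carrier A. 0 < v (alg_dia A a) \<longrightarrow>
        (\<exists>w\<in>W. v (alg_dia A a) \<le> w a \<and> acc_ge (v (alg_dia A a)) v w))"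

text \<open>Saturation asks only for the existence of witnesses, so a separate saturated set may be
  built for each element that has to be kept below 1.\<close>

lemma saturated_Union: "(\<And>W. W \<in> \<W> \<Longrightarrow> saturated W) \<Longrightarrow> saturated (\<Union>\<W>)"
  unfolding saturated_def by blast

lemma godel_homD:
  assumes "godel_hom w"
  shows "a \<in> carrier A \<Longrightarrow> 0 \<le> w a" "a \<in> carrier A \<Longrightarrow> w a \<le> 1"
    "w (alg_bot A) = 0" "w (alg_top A) = 1"
    "\<lbrakk>a \<in> carrier A; b \<in> carrier A\<rbrakk> \<Longrightarrow> w (alg_meet A a b) = min (w a) (w b)"
    "\<lbrakk>a \<in> carrier A; b \<in> carrier A\<rbrakk> \<Longrightarrow> w (alg_join A a b) = max (w a) (w b)"
    "\<lbrakk>a \<in> carrier A; b \<in> carrier A\<rbrakk> \<Longrightarrow> w (alg_imp A a b) = godel_imp (w a) (w b)"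
  using assms unfolding godel_hom_def by auto

lemma godel_imp_bounds: "\<lbrakk>0 \<le> b; b \<le> 1\<rbrakk> \<Longrightarrow> 0 \<le> godel_imp a b \<and> godel_imp a b \<le> 1"
  by (simp add: godel_imp_def)

lemma acc_le:
  assumes v: "godel_hom v" and w: "godel_hom w" and a: "a \<in> carrier A"
  shows "acc v w \<le> godel_imp (v (alg_box A a)) (w a)" "acc v w \<le> godel_imp (w a) (v (alg_dia A a))"
proof -
  have "acc v w \<le> min (godel_imp (v (alg_box A a)) (w a)) (godel_imp (w a) (v (alg_dia A a)))"
    unfolding acc_def
    by (rule cINF_lower[OF bdd_belowI2[of _ 0] a])
      (simp add: godel_imp_bounds godel_homD[OF v] godel_homD[OF w] dia_closed)
  then show "acc v w \<le> godel_imp (v (alg_box A a)) (w a)" "acc v w \<le> godel_imp (w a) (v (alg_dia A a))"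
    by simp_all
qed

lemma acc_ge_le_acc:
  assumes "acc_ge s v w" "s \<le> 1"
  shows "s \<le> acc v w"
  unfolding acc_def
  by (rule cINF_greatest) (use assms top_closed in \<open>auto simp: acc_ge_def godel_imp_def\<close>)

lemma acc_bounds:
  assumes v: "godel_hom v" and w: "godel_hom w"
  shows "0 \<le> acc v w" "acc v w \<le> 1"
proof -
  show "0 \<le> acc v w" unfolding acc_def
    by (rule cINF_greatest)
      (use top_closed in \<open>auto simp: godel_imp_bounds godel_homD[OF v] godel_homD[OF w] dia_closed\<close>)
  show "acc v w \<le> 1"
    using acc_le(1)[OF v w top_closed] godel_imp_bounds[of "w (alg_top A)" "v (alg_box A (alg_top A))"]
    by (simp add: godel_homD[OF w])
qed

lemma saturated_box:
  assumes W: "saturated W" and v: "v \<in> W" and a[simp]: "a \<in> carrier A"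
  shows "(INF w\<in>W. godel_imp (acc v w) (w a)) = v (alg_box A a)"
proof (rule antisym)
  have hom: "godel_hom w" if "w \<in> W" for w using W that by (simp add: saturated_def)
  \<comment> \<open>If \<open>acc v w\<close> exceeds w a, then by \<open>acc_le\<close> the
    implication from v (\<box>a) to w a exceeds w a too, so it is 1 and v (\<box>a) \<le> w
    a.\<close>
  have lower: "v (alg_box A a) \<le> godel_imp (acc v w) (w a)" if w: "w \<in> W" for w
    using acc_le(1)[OF hom[OF v] hom[OF w] a] godel_homD(2)[OF hom[OF v], of "alg_box A a"]
    by (auto simp: godel_imp_def box_closed split: if_splits)
  then show "v (alg_box A a) \<le> (INF w\<in>W. godel_imp (acc v w) (w a))"
    using v by (intro cINF_greatest) auto
  have INF_le: "(INF w\<in>W. godel_imp (acc v w) (w a)) \<le> godel_imp (acc v w) (w a)" if "w \<in> W" for w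
    by (rule cINF_lower[OF bdd_belowI2[OF lower] that])
  show "(INF w\<in>W. godel_imp (acc v w) (w a)) \<le> v (alg_box A a)"
  proof (cases "v (alg_box A a) < 1")
    case True
    show ?thesis
    proof (rule field_le_epsilon)
      fix \<epsilon> :: real assume "\<epsilon> > 0"
      then obtain w s where w: "w \<in> W" "s \<le> 1" "w a < s" "w a < v (alg_box A a) + \<epsilon>" "acc_ge s v w"
        using W v True a unfolding saturated_def by meson
      have "s \<le> acc v w" by (rule acc_ge_le_acc[OF w(5,2)])
      \<comment> \<open>Here w a < s must be strict.\<close>
      then have "godel_imp (acc v w) (w a) = w a" using w(3) by (simp add: godel_imp_def)
      then show "(INF w\<in>W. godel_imp (acc v w) (w a)) \<le> v (alg_box A a) + \<epsilon>"
        using INF_le[OF w(1)] w(4) by simp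
    qed
  next
    case False
    then show ?thesis
      using INF_le[OF v] godel_imp_bounds[of "v a" "acc v v"] godel_homD[OF hom[OF v]] by fastforce
  qed
qed

lemma saturated_dia:
  assumes W: "saturated W" and v: "v \<in> W" and a[simp]: "a \<in> carrier A"
  shows "(SUP w\<in>W. min (acc v w) (w a)) = v (alg_dia A a)"
proof (rule antisym)
  have hom: "godel_hom w" if "w \<in> W" for w using W that by (simp add: saturated_def)
  have upper: "min (acc v w) (w a) \<le> v (alg_dia A a)" if w: "w \<in> W" for w
    using acc_le(2)[OF hom[OF v] hom[OF w] a] by (auto simp: godel_imp_def split: if_splits)
  then show "(SUP w\<in>W. min (acc v w) (w a)) \<le> v (alg_dia A a)"
    using v by (intro cSUP_least) auto
  have le_SUP: "min (acc v w) (w a) \<le> (SUP w\<in>W. min (acc v w) (w a))" if "w \<in> W" for w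
    by (rule cSUP_upper[OF that bdd_aboveI2[OF upper]])
  show "v (alg_dia A a) \<le> (SUP w\<in>W. min (acc v w) (w a))"
  proof (cases "0 < v (alg_dia A a)")
    case True
    then obtain w where w: "w \<in> W" "v (alg_dia A a) \<le> w a" "acc_ge (v (alg_dia A a)) v w"
      using W v a unfolding saturated_def by meson
    have "v (alg_dia A a) \<le> acc v w"
      by (rule acc_ge_le_acc[OF w(3)]) (simp add: godel_homD[OF hom[OF v]] dia_closed)
    then show ?thesis using le_SUP[OF w(1)] w(2) by simp
  next
    case False
    \<comment> \<open>At value 0 any world gives the bound, for instance v.\<close>
    then have "v (alg_dia A a) \<le> min (acc v v) (v a)"
      using acc_bounds(1)[OF hom[OF v] hom[OF v]] godel_homD(1)[OF hom[OF v] a] by linarith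
    then show ?thesis using le_SUP[OF v] by linarith
  qed
qed

lemma saturated_frame: "\<lbrakk>saturated W; W \<noteq> {}\<rbrakk> \<Longrightarrow> gk_frame W acc"
  by (auto simp: gk_frame_def saturated_def acc_bounds)

text \<open>Separation from the top is enough for injectivity: if a \<noteq> b, one of the two
  implications between them is not 1, and a world where it is below 1 tells a from b.\<close>

lemma saturated_embedding:
  assumes W: "saturated W"
    and sep: "\<And>a. \<lbrakk>a \<in> carrier A; a \<noteq> alg_top A\<rbrakk> \<Longrightarrow> \<exists>w\<in>W. w a < 1"
  shows "bimodal_embedding A (complex_algebra W acc) (\<lambda>a. \<lambda>w\<in>W. w a)"
proof -
  have hom: "godel_hom w" if "w \<in> W" for w using W that by (simp add: saturated_def)
  note H = godel_homD[OF hom]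
  have "bimodal_hom A (complex_algebra W acc) (\<lambda>a. \<lambda>w\<in>W. w a)"
    unfolding bimodal_hom_def complex_algebra_def
    by (auto simp: H saturated_box[OF W] saturated_dia[OF W] intro!: restrict_ext)
  moreover have "inj_on (\<lambda>a. \<lambda>w\<in>W. w a) (carrier A)"
  proof (rule inj_onI, rule ccontr)
    fix a b assume ab[simp]: "a \<in> carrier A" "b \<in> carrier A" and eq: "(\<lambda>w\<in>W. w a) = (\<lambda>w\<in>W. w b)" and "a \<noteq> b"
    then have "\<not> alg_le A a b \<or> \<not> alg_le A b a" using le_antisym by blast
    then obtain w where w: "w \<in> W" "w (alg_imp A a b) < 1 \<or> w (alg_imp A b a) < 1"
      using sep[of "alg_imp A a b"] sep[of "alg_imp A b a"] by (auto simp: imp_eq_top imp_closed)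
    have "w a = w b" using eq w(1) by (metis restrict_apply')
    then show False using w H(7)[OF w(1)] by (simp add: godel_imp_def)
  qed
  ultimately show ?thesis by (simp add: bimodal_embedding_def)
qed

end

section \<open>Truth in the model induced by an embedding\<close>

lemma (in bimodal_godel_algebra) alg_eval_closed:
  "alg_valuation A v \<Longrightarrow> alg_eval A v \<phi> \<in> carrier A"
  by (induction \<phi>) (auto simp: alg_valuation_def modal_closed)

lemma (in bimodal_godel_algebra) gk_eval_embedding:
  assumes h: "bimodal_hom A (complex_algebra W S) h" and v: "alg_valuation A v" and "w \<in> W"
  shows "gk_eval W S (\<lambda>w p. h (v p) w) w \<phi> = h (alg_eval A v \<phi>) w"
  using \<open>w \<in> W\<close>
proof (induction \<phi> arbitrary: w)
  case (Box \<phi>)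
  then show ?case
    using h alg_eval_closed[OF v, of \<phi>] by (simp add: bimodal_hom_def complex_algebra_def cong: image_cong_simp)
next
  case (Dia \<phi>)
  then show ?case
    using h alg_eval_closed[OF v, of \<phi>] by (simp add: bimodal_hom_def complex_algebra_def cong: image_cong_simp)
qed (use h alg_eval_closed[OF v] in \<open>auto simp: bimodal_hom_def complex_algebra_def\<close>)

text \<open>Any embedding serves: atoms are evaluated through \<open>h\<close>, and injectivity
  turns the constant value 1 back into equality with the top.\<close>

lemma (in bimodal_godel_algebra) embedding_gk_valid:
  assumes W: "gk_frame W S" and h: "bimodal_embedding A (complex_algebra W S) h" and v: "alg_valuation A v"
  shows "\<exists>e. gk_model W S e \<and> (\<forall>\<phi>. alg_eval A v \<phi> = alg_top A \<longleftrightarrow> gk_valid W S e \<phi>)"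
proof (intro exI conjI allI)
  have hom: "bimodal_hom A (complex_algebra W S) h" and inj: "inj_on h (carrier A)"
    using h by (simp_all add: bimodal_embedding_def)
  have mem: "h a \<in> W \<rightarrow>\<^sub>E {0..1}" if "a \<in> carrier A" for a
    using hom that by (auto simp: bimodal_hom_def complex_algebra_def)
  let ?e = "\<lambda>w p. h (v p) w"
  show "gk_model W S ?e"
    using W mem v by (fastforce simp: gk_model_def alg_valuation_def)
  fix \<phi>
  have c: "alg_eval A v \<phi> \<in> carrier A" by (rule alg_eval_closed[OF v])
  have top: "h (alg_top A) = (\<lambda>w\<in>W. 1)" using hom by (simp add: bimodal_hom_def complex_algebra_def)
  have "alg_eval A v \<phi> = alg_top A \<longleftrightarrow> h (alg_eval A v \<phi>) = h (alg_top A)"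
    using inj_on_eq_iff[OF inj c top_closed] by simp
  also have "\<dots> \<longleftrightarrow> (\<forall>w\<in>W. h (alg_eval A v \<phi>) w = 1)"
    unfolding top using mem[OF c] by (auto simp: fun_eq_iff PiE_def extensional_def)
  also have "\<dots> \<longleftrightarrow> gk_valid W S ?e \<phi>"
    by (simp add: gk_valid_def gk_eval_embedding[OF hom v])
  finally show "alg_eval A v \<phi> = alg_top A \<longleftrightarrow> gk_valid W S ?e \<phi>" .
qed

section \<open>Existence of saturated sets\<close>

context bimodal_godel_algebra
begin

text \<open>Points of a world with truth filter \<open>M\<close>: the elements of the algebra, ordered as in the chain
  \<open>A/M\<close>, together with an auxiliary value \<open>None\<close> lying between \<open>1\<close> and all other elements.\<close>
definition pts :: "'a option set" where
  "pts = insert None (Some ` carrier A)"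

fun fib :: "'a set \<Rightarrow> 'a option \<Rightarrow> 'a option \<Rightarrow> bool" where
  "fib M (Some b) (Some c) \<longleftrightarrow> alg_imp A b c \<in> M"
| "fib M (Some b) None \<longleftrightarrow> b \<notin> M"
| "fib M None (Some c) \<longleftrightarrow> c \<in> M"
| "fib M None None \<longleftrightarrow> True"

lemma None_pts [simp]: "None \<in> pts" and Some_pts [simp]: "Some b \<in> pts \<longleftrightarrow> b \<in> carrier A"
  by (auto simp: pts_def)

lemma fib_trans:
  assumes M: "prime_filt M" and xy: "fib M x y" and yz: "fib M y z" and mem: "x \<in> pts" "y \<in> pts" "z \<in> pts"
  shows "fib M x z"
proof -
  note F = prime_filtD(1)[OF M]
  show ?thesis
    using xy yz mem
    by (cases x; cases y; cases z; simp;
        blast intro: filt_imp_trans[OF F] filt_mp[OF F] filt_imp_right[OF F])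
qed

lemma fib_total_preorder:
  assumes M: "prime_filt M"
  shows "total_preorder pts (fib M)"
proof -
  have "fib M x y \<or> fib M y x" if "x \<in> pts" "y \<in> pts" for x y
    using that prime_filt_linear[OF M] by (cases x; cases y) auto
  then show ?thesis using fib_trans[OF M] unfolding total_preorder_def by blast
qed

lemma fib_top:
  assumes M: "prime_filt M" and g: "g \<in> M" and x: "x \<in> pts"
  shows "fib M x (Some g)"
  using x g filt_imp_right[OF prime_filtD(1)[OF M] g] by (cases x) simp_all

lemma fib_topD:
  assumes M: "prime_filt M" and de: "fib M d e" and d: "d \<in> Some ` M" and e: "e \<in> pts"
  shows "e \<in> Some ` M"
proof -
  obtain b where b: "d = Some b" "b \<in> M" using d by blast
  obtain c where "e = Some c" "c \<in> carrier A" using de b e by (cases e) simp_all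
  then show ?thesis using filt_mp[OF prime_filtD(1)[OF M] b(2), of c] de b(1) by simp
qed

text \<open>These are the compatibility conditions for squeezing b between \<box>b and \<diamond>b.
  If the first failed, \<box>b \<rightarrow> \<diamond>c would collapse to \<diamond>c modulo
  \<open>M\<close>; as \<diamond>(b \<rightarrow> c) \<in> F lies below this implication,
  \<diamond>c and then the larger \<box>b would be in \<open>F\<close>, forcing b \<in> G. The
  second is the other mixed axiom followed by \<open>box\<close>.\<close>

lemma successor_sandwich:
  assumes M: "prime_filt M" and F: "prime_filt F" and G: "prime_filt G" and MF: "M \<subseteq> F"
    and box: "\<And>b. \<lbrakk>b \<in> carrier A; alg_box A b \<in> F\<rbrakk> \<Longrightarrow> b \<in> G"
    and dia: "\<And>b. b \<in> G \<Longrightarrow> alg_dia A b \<in> F"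
    and [simp]: "b \<in> carrier A" "c \<in> carrier A"
  shows "\<lbrakk>b \<notin> G; alg_imp A b c \<in> G\<rbrakk> \<Longrightarrow> alg_imp A (alg_box A b) (alg_dia A c) \<in> M"
    and "alg_imp A (alg_dia A c) (alg_box A b) \<in> M \<Longrightarrow> alg_imp A c b \<in> G"
proof -
  note [simp] = modal_closed
  note fM = prime_filtD(1)[OF M] and fF = prime_filtD(1)[OF F]
  let ?i = "alg_imp A (alg_box A b) (alg_dia A c)"
  { assume b: "b \<notin> G" and bc: "alg_imp A b c \<in> G"
    show "?i \<in> M"
    proof (rule ccontr)
      assume no: "?i \<notin> M"
      have "?i \<in> F" using filtD(4)[OF fF dia[OF bc] _ dia_imp] by simp
      moreover have "alg_imp A ?i (alg_dia A c) \<in> F"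
        using prime_filt_imp_imp[OF M _ _ no] MF by auto
      ultimately have "alg_dia A c \<in> F" by (rule filt_mp[OF fF]) simp
      moreover have "alg_imp A (alg_dia A c) (alg_box A b) \<in> F"
        using prime_filt_linear[OF M, of "alg_box A b" "alg_dia A c"] no MF by auto
      ultimately have "alg_box A b \<in> F" by (rule filt_mp[OF fF]) simp
      then show False using box[of b] b by simp
    qed }
  { assume "alg_imp A (alg_dia A c) (alg_box A b) \<in> M"
    then have "alg_box A (alg_imp A c b) \<in> F"
      using filtD(4)[OF fF _ _ dia_imp_box] MF by auto
    then show "alg_imp A c b \<in> G" using box[of "alg_imp A c b"] by simp }
qed

text \<open>\<open>N\<close> indexes the worlds; \<open>R\<close> compares the values taken in all of them, \<open>(i, Some b)\<close> standing for
  the value of world \<open>i\<close> at \<open>b\<close>.\<close>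
definition state :: "nat set \<Rightarrow> (nat \<times> 'a option \<Rightarrow> nat \<times> 'a option \<Rightarrow> bool) \<Rightarrow> bool" where
  "state N R \<longleftrightarrow> total_preorder (N \<times> pts) R \<and>
     (\<forall>i\<in>N. \<exists>M. prime_filt M \<and> (\<forall>x\<in>pts. \<forall>y\<in>pts. R (i, x) (i, y) \<longleftrightarrow> fib M x y)) \<and>
     (\<forall>i\<in>N. \<forall>j\<in>N. R (i, Some (alg_bot A)) (j, Some (alg_bot A)) \<and>
        R (i, Some (alg_top A)) (j, Some (alg_top A)))"

lemma stateD:
  assumes "state N R"
  shows "total_preorder (N \<times> pts) R"
    and "i \<in> N \<Longrightarrow> \<exists>M. prime_filt M \<and> (\<forall>x\<in>pts. \<forall>y\<in>pts. R (i, x) (i, y) \<longleftrightarrow> fib M x y)"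
    and "\<lbrakk>i \<in> N; j \<in> N\<rbrakk> \<Longrightarrow> R (i, Some (alg_bot A)) (j, Some (alg_bot A))"
    and "\<lbrakk>i \<in> N; j \<in> N\<rbrakk> \<Longrightarrow> R (i, Some (alg_top A)) (j, Some (alg_top A))"
  using assms unfolding state_def by blast+

lemma state_top:
  assumes S: "state N R" and x: "x \<in> N \<times> pts" and j: "j \<in> N"
  shows "R x (j, Some (alg_top A))"
proof -
  obtain i p where [simp]: "x = (i, p)" and i: "i \<in> N" "p \<in> pts" using x by auto
  obtain M where M: "prime_filt M" "\<forall>x\<in>pts. \<forall>y\<in>pts. R (i, x) (i, y) \<longleftrightarrow> fib M x y"
    using stateD(2)[OF S i(1)] by blast
  have "R x (i, Some (alg_top A))"
    using M fib_top[OF M(1) filtD(2)[OF prime_filtD(1)[OF M(1)]] i(2)] i top_closed by simp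
  then show ?thesis
    using total_preorderD(2)[OF stateD(1)[OF S] _ stateD(4)[OF S i(1) j]] i j x top_closed by simp
qed

lemma state_bot:
  assumes S: "state N R" and x: "x \<in> N \<times> pts" and j: "j \<in> N"
  shows "R (j, Some (alg_bot A)) x"
proof -
  obtain i p where [simp]: "x = (i, p)" and i: "i \<in> N" "p \<in> pts" using x by auto
  obtain M where M: "prime_filt M" "\<forall>x\<in>pts. \<forall>y\<in>pts. R (i, x) (i, y) \<longleftrightarrow> fib M x y"
    using stateD(2)[OF S i(1)] by blast
  have "fib M (Some (alg_bot A)) p"
    using prime_filtD(2)[OF M(1)] filt_imp_le[OF prime_filtD(1)[OF M(1)] bot_least] i(2) bot_closed
    by (cases p) auto
  then have "R (i, Some (alg_bot A)) x" using M i bot_closed by simp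
  then show ?thesis
    using total_preorderD(2)[OF stateD(1)[OF S] stateD(3)[OF S j i(1)]] i j x bot_closed by simp
qed

text \<open>\<open>H\<close> continues the cut \<open>F\<close> from the values of world m to all
  existing points. Placing the points of the new world other than its 1 below \<open>H\<close> makes
  its auxiliary point a common lower bound of the cut, and so usable as a degree of
  accessibility.\<close>

lemma state_extend:
  assumes S: "state N R" and m: "m \<in> N" and n: "n \<notin> N"
    and M: "prime_filt M" "\<forall>x\<in>pts. \<forall>y\<in>pts. R (m, x) (m, y) \<longleftrightarrow> fib M x y"
    and H': "\<forall>x\<in>N \<times> pts. \<forall>y\<in>N \<times> pts. H x \<longrightarrow> R x y \<longrightarrow> H y"
    and F: "F = {b \<in> carrier A. H (m, Some b)}" "prime_filt F" "M \<subseteq> F"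
    and G': "prime_filt G" "\<forall>b\<in>carrier A. alg_box A b \<in> F \<longrightarrow> b \<in> G" "\<forall>b\<in>G. alg_dia A b \<in> F"
  shows "\<exists>T. state (insert n N) T \<and> (\<forall>x\<in>N \<times> pts. \<forall>y\<in>N \<times> pts. T x y \<longleftrightarrow> R x y) \<and>
    (\<forall>x\<in>pts. \<forall>y\<in>pts. T (n, x) (n, y) \<longleftrightarrow> fib G x y) \<and>
    (\<forall>b\<in>carrier A. T (m, Some (alg_box A b)) (n, Some b)) \<and>
    (\<forall>b\<in>carrier A - G. T (n, Some b) (m, Some (alg_dia A b))) \<and>
    (\<forall>d\<in>pts - Some ` G. \<forall>x\<in>N \<times> pts. H x \<longrightarrow> T (n, d) x)"
proof -
  note [simp] = modal_closed m
  note G = G'(1) G'(2)[rule_format] G'(3)[rule_format]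
  have H: "H y" if "H x" "R x y" "x \<in> N \<times> pts" "y \<in> N \<times> pts" for x y
    using H' that by blast
  let ?X = "N \<times> pts" and ?Y = "{n} \<times> pts"
  note R = stateD(1)[OF S]
  note RD = total_preorderD[OF R]
  note fM = prime_filtD(1)[OF M(1)] and fG = prime_filtD(1)[OF G(1)]
  note sandwich = successor_sandwich[OF M(1) F(2) G(1) F(3) G(2,3)]
  note ft = fib_trans[OF G(1)]
  define E where "E = (\<lambda>(i :: nat, x) (j :: nat, y). fib G x y)"
  \<comment> \<open>\<open>P\<close> and \<open>Q\<close> close the wanted inequalities under both
    orders: \<box>b \<le> b, and b \<le> \<diamond>b outside \<open>G\<close>. \<open>Q\<close>
    moreover puts everything below the old top, and the points outside \<open>G\<close> below the
    cut. For the top, \<open>P\<close> already suffices because I1 = 1.\<close>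
  define P where "P = (\<lambda>x (j :: nat, d). \<exists>b\<in>carrier A. fib G (Some b) d \<and> R x (m, Some (alg_box A b)))"
  define Q where "Q = (\<lambda>(j :: nat, d) x. R (m, Some (alg_top A)) x \<or>
    (\<exists>b\<in>carrier A - G. fib G d (Some b) \<and> R (m, Some (alg_dia A b)) x) \<or> (d \<notin> Some ` G \<and> H x))"
  have boxF: "b \<in> G" if "H (m, Some (alg_box A b))" "b \<in> carrier A" for b
    using G(2)[of b] that by (simp add: F(1))
  have PX: "P x y" if xx: "R x x'" and P: "P x' y" and mem: "x \<in> ?X" "x' \<in> ?X" "y \<in> ?Y" for x x' y
  proof -
    obtain d where [simp]: "y = (n, d)" using mem by auto
    obtain b where b: "b \<in> carrier A" "fib G (Some b) d" "R x' (m, Some (alg_box A b))"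
      using P by (auto simp: P_def)
    have "R x (m, Some (alg_box A b))" using RD(2)[OF xx b(3) mem(1,2)] b(1) by simp
    then show ?thesis using b by (auto simp: P_def)
  qed
  have PY: "P x y'" if P: "P x y" and yy: "E y y'" and mem: "x \<in> ?X" "y \<in> ?Y" "y' \<in> ?Y" for x y y'
  proof -
    obtain d d' where [simp]: "y = (n, d)" "y' = (n, d')" and d: "d \<in> pts" "d' \<in> pts" using mem by auto
    obtain b where b: "b \<in> carrier A" "fib G (Some b) d" "R x (m, Some (alg_box A b))"
      using P by (auto simp: P_def)
    have "fib G (Some b) d'" using ft[OF b(2), of d'] yy b(1) d by (simp add: E_def)
    then show ?thesis using b by (auto simp: P_def)
  qed
  have QX: "Q y x'" if "Q y x" "R x x'" "x \<in> ?X" "x' \<in> ?X" "y \<in> ?Y" for x x' y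
  proof -
    have "R (m, Some b) x'" if "R (m, Some b) x" "b \<in> carrier A" for b
      using RD(2)[OF that(1) \<open>R x x'\<close> _ \<open>x \<in> ?X\<close> \<open>x' \<in> ?X\<close>] that by simp
    then show ?thesis
      using that(1) H[OF _ that(2,3,4)] unfolding Q_def by (cases y) (auto simp del: fib.simps)
  qed
  have QY: "Q y x" if yy: "E y y'" and Q: "Q y' x" and mem: "x \<in> ?X" "y \<in> ?Y" "y' \<in> ?Y" for x y y'
  proof -
    obtain d d' where [simp]: "y = (n, d)" "y' = (n, d')" and d: "d \<in> pts" "d' \<in> pts" using mem by auto
    have dd: "fib G d d'" using yy by (simp add: E_def)
    have "fib G d (Some b)" if "fib G d' (Some b)" "b \<in> carrier A" for b
      using ft[OF dd that(1)] d that by simp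
    moreover have "d \<notin> Some ` G" if "d' \<notin> Some ` G" using that fib_topD[OF G(1) dd _ d(2)] by blast
    ultimately show ?thesis using Q unfolding Q_def by (auto simp del: fib.simps)
  qed
  have PQ: "R x x'" if P: "P x y" and Q: "Q y x'" and mem: "x \<in> ?X" "x' \<in> ?X" "y \<in> ?Y" for x x' y
  proof -
    obtain d where [simp]: "y = (n, d)" and d: "d \<in> pts" using mem by auto
    obtain b where b: "b \<in> carrier A" "fib G (Some b) d" "R x (m, Some (alg_box A b))"
      using P by (auto simp: P_def)
    have goal: "R x x'" if "R (m, Some (alg_box A b)) x'"
      using RD(2)[OF b(3) that mem(1) _ mem(2)] b(1) by simp
    consider "R (m, Some (alg_top A)) x'"
      | c where "c \<in> carrier A" "c \<notin> G" "fib G d (Some c)" "R (m, Some (alg_dia A c)) x'"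
      | "d \<notin> Some ` G" "H x'"
      using Q by (auto simp: Q_def)
    then show ?thesis
    proof cases
      case 1
      have "R (m, Some (alg_box A b)) (m, Some (alg_top A))" using state_top[OF S _ m] b(1) by simp
      then show ?thesis using goal RD(2)[OF _ 1] b(1) mem by simp
    next
      case 2
      have bc: "alg_imp A b c \<in> G" using ft[OF b(2) 2(3)] b(1) 2(1) d by simp
      have "b \<notin> G" using filt_mp[OF fG _ bc] 2(1,2) by blast
      then have "fib M (Some (alg_box A b)) (Some (alg_dia A c))"
        using sandwich(1)[of b c] bc b(1) 2(1) by simp
      then have "R (m, Some (alg_box A b)) (m, Some (alg_dia A c))"
        using M(2) b(1) 2(1) by simp
      then show ?thesis using goal RD(2)[OF _ 2(4)] b(1) 2(1) mem by simp
    next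
      case 3
      \<comment> \<open>The cut separates: \<open>x'\<close> lies above it, whereas \<box>b does
        not, since otherwise b and with it d would be in the top class.\<close>
      have "b \<notin> G" using fib_topD[OF G(1) b(2) _ d] 3 by blast
      then have "\<not> H (m, Some (alg_box A b))" using boxF b(1) by blast
      then have "\<not> R x' (m, Some (alg_box A b))" using H[OF 3(2) _ mem(2)] b(1) by auto
      then show ?thesis using goal RD(1)[of x' "(m, Some (alg_box A b))"] mem(2) b(1) by simp
    qed
  qed
  have QP: "E y y'" if Q: "Q y x" and P: "P x y'" and mem: "x \<in> ?X" "y \<in> ?Y" "y' \<in> ?Y" for x y y'
  proof -
    obtain d d' where [simp]: "y = (n, d)" "y' = (n, d')" and d: "d \<in> pts" "d' \<in> pts" using mem by auto
    obtain b where b: "b \<in> carrier A" "fib G (Some b) d'" "R x (m, Some (alg_box A b))"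
      using P by (auto simp: P_def)
    have goal: "fib G d d'" if "b \<in> G"
    proof -
      obtain g where "d' = Some g" "g \<in> G" using fib_topD[OF G(1) b(2) _ d(2)] \<open>b \<in> G\<close> by blast
      then show ?thesis using fib_top[OF G(1) _ d(1)] by simp
    qed
    consider "R (m, Some (alg_top A)) x"
      | c where "c \<in> carrier A" "c \<notin> G" "fib G d (Some c)" "R (m, Some (alg_dia A c)) x"
      | "d \<notin> Some ` G" "H x"
      using Q by (auto simp: Q_def)
    then have "fib G d d'"
    proof cases
      \<comment> \<open>Now x has value 1, hence so has \<box>b; thus b \<in> G and d' is at the
        top.\<close>
      case 1
      then have "R (m, Some (alg_top A)) (m, Some (alg_box A b))"
        using RD(2)[OF 1 b(3)] mem(1) b(1) by simp
      then have "alg_imp A (alg_top A) (alg_box A b) \<in> M" using M(2) b(1) by simp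
      then have "alg_box A b \<in> M" by (rule filt_mp[OF fM filtD(2)[OF fM]]) (use b(1) in simp)
      then show ?thesis using goal G(2) F(3) b(1) by blast
    next
      case 2
      then have "R (m, Some (alg_dia A c)) (m, Some (alg_box A b))"
        using RD(2)[OF 2(4) b(3)] mem(1) b(1) by simp
      then have "alg_imp A (alg_dia A c) (alg_box A b) \<in> M" using M(2) b(1) 2(1) by simp
      then have "fib G (Some c) (Some b)" using sandwich(2)[of b c] b(1) 2(1) by simp
      then show ?thesis using ft[OF ft[OF 2(3)] b(2)] b(1) 2(1) d by simp
    next
      case 3
      then show ?thesis using goal boxF H[OF 3(2) b(3) mem(1)] b(1) by simp
    qed
    then show ?thesis by (simp add: E_def)
  qed
  have disj: "?X \<inter> ?Y = {}" using n by auto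
  have E: "total_preorder ?Y E"
    using total_preorderD(1)[OF fib_total_preorder[OF G(1)]] ft
    unfolding total_preorder_def E_def by blast
  have "\<exists>T. total_preorder (?X \<union> ?Y) T \<and> (\<forall>x\<in>?X. \<forall>x'\<in>?X. T x x' \<longleftrightarrow> R x x') \<and>
    (\<forall>y\<in>?Y. \<forall>y'\<in>?Y. T y y' \<longleftrightarrow> E y y') \<and> (\<forall>x\<in>?X. \<forall>y\<in>?Y. (P x y \<longrightarrow> T x y) \<and> (Q y x \<longrightarrow> T y x))"
    by (rule total_preorder_amalgam[where R = R and E = E and P = P and Q = Q])
      (fact disj R E PX PY QX QY PQ QP)+
  then obtain T where T': "total_preorder (?X \<union> ?Y) T" "\<forall>x\<in>?X. \<forall>x'\<in>?X. T x x' \<longleftrightarrow> R x x'"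
    "\<forall>y\<in>?Y. \<forall>y'\<in>?Y. T y y' \<longleftrightarrow> E y y'" "\<forall>x\<in>?X. \<forall>y\<in>?Y. (P x y \<longrightarrow> T x y) \<and> (Q y x \<longrightarrow> T y x)"
    by (elim exE conjE)
  have T: "total_preorder (?X \<union> ?Y) T"
    "\<And>x x'. \<lbrakk>x \<in> ?X; x' \<in> ?X\<rbrakk> \<Longrightarrow> T x x' \<longleftrightarrow> R x x'"
    "\<And>y y'. \<lbrakk>y \<in> ?Y; y' \<in> ?Y\<rbrakk> \<Longrightarrow> T y y' \<longleftrightarrow> E y y'"
    "\<And>x y. \<lbrakk>x \<in> ?X; y \<in> ?Y; P x y\<rbrakk> \<Longrightarrow> T x y"
    "\<And>x y. \<lbrakk>x \<in> ?X; y \<in> ?Y; Q y x\<rbrakk> \<Longrightarrow> T y x"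
    using T' by blast+
  have un: "?X \<union> ?Y = insert n N \<times> pts" by auto
  note TD = total_preorderD[OF T(1)]
  have TE: "T (n, x) (n, y) \<longleftrightarrow> fib G x y" if "x \<in> pts" "y \<in> pts" for x y
    using T(3)[of "(n, x)" "(n, y)"] that by (simp add: E_def)
  have Tbox: "T (m, Some (alg_box A b)) (n, Some b)" if b: "b \<in> carrier A" for b
  proof (rule T(4))
    have "fib G (Some b) (Some b)" using filt_imp_le[OF fG le_refl] b by simp
    then show "P (m, Some (alg_box A b)) (n, Some b)"
      using b RD(3)[of "(m, Some (alg_box A b))"] unfolding P_def by auto
  qed (use b in simp_all)
  have Tdia: "T (n, Some b) (m, Some (alg_dia A b))" if b: "b \<in> carrier A" "b \<notin> G" for b
  proof (rule T(5))
    have "fib G (Some b) (Some b)" using filt_imp_le[OF fG le_refl] b by simp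
    then show "Q (n, Some b) (m, Some (alg_dia A b))"
      using b RD(3)[of "(m, Some (alg_dia A b))"] unfolding Q_def by auto
  qed (use b in simp_all)
  have TH: "T (n, d) x" if "d \<in> pts" "d \<notin> Some ` G" "x \<in> ?X" "H x" for d x
    by (rule T(5)) (use that in \<open>auto simp: Q_def\<close>)
  \<comment> \<open>The ends of the new world match the old ones because K0 = 0 and, below, I1 =
    1.\<close>
  have bot: "T (n, Some (alg_bot A)) (m, Some (alg_bot A))" "T (m, Some (alg_bot A)) (n, Some (alg_bot A))"
  proof -
    show "T (n, Some (alg_bot A)) (m, Some (alg_bot A))"
      using Tdia[OF bot_closed prime_filtD(2)[OF G(1)]] by (simp add: dia_bot)
    have "T (m, Some (alg_bot A)) (m, Some (alg_box A (alg_bot A)))"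
      using state_bot[OF S _ m] T(2) by simp
    from TD(2)[OF this Tbox[OF bot_closed]] show "T (m, Some (alg_bot A)) (n, Some (alg_bot A))" by simp
  qed
  have top: "T (n, Some (alg_top A)) (m, Some (alg_top A))" "T (m, Some (alg_top A)) (n, Some (alg_top A))"
  proof -
    show "T (n, Some (alg_top A)) (m, Some (alg_top A))"
      by (rule T(5)) (use RD(3)[of "(m, Some (alg_top A))"] in \<open>auto simp: Q_def\<close>)
    show "T (m, Some (alg_top A)) (n, Some (alg_top A))"
      using Tbox[OF top_closed] by (simp add: box_top)
  qed
  have ends: "T (i, Some c) (j, Some c)" if ij: "i \<in> insert n N" "j \<in> insert n N" and c: "c \<in> {alg_bot A, alg_top A}" for i j c
  proof -
    have mn: "T (n, Some c) (m, Some c)" "T (m, Some c) (n, Some c)" using bot top c by auto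
    have N: "T (i, Some c) (j, Some c)" if "i \<in> N" "j \<in> N" for i j
      using T(2)[of "(i, Some c)" "(j, Some c)"] stateD(3,4)[OF S that] that c by auto
    have cl: "Some c \<in> pts" using c by auto
    have "T (i, Some c) (m, Some c)" "T (m, Some c) (j, Some c)" using ij mn N m by auto
    then show ?thesis using TD(2)[of "(i, Some c)" "(m, Some c)" "(j, Some c)"] ij cl by auto
  qed
  have "state (insert n N) T" unfolding state_def
  proof (intro conjI ballI)
    show "total_preorder (insert n N \<times> pts) T" using T(1) un by simp
    fix i assume i: "i \<in> insert n N"
    show "\<exists>M. prime_filt M \<and> (\<forall>x\<in>pts. \<forall>y\<in>pts. T (i, x) (i, y) \<longleftrightarrow> fib M x y)"
    proof (cases "i = n")
      case True
      then show ?thesis using G(1) TE by blast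
    next
      case False
      then show ?thesis using stateD(2)[OF S, of i] T(2) i by auto
    qed
  qed (rule ends; simp)+
  then show ?thesis using T(2) TE Tbox Tdia TH by blast
qed

end

section \<open>Witnesses for a single request\<close>

context bimodal_godel_algebra
begin

text \<open>\<open>w\<close> is accessible from \<open>m\<close> to degree at least \<open>s\<close>; after embedding into \<open>[0,1]\<close> this becomes
  \<^const>\<open>acc_ge\<close>.\<close>
definition successor :: "(nat \<times> 'a option \<Rightarrow> nat \<times> 'a option \<Rightarrow> bool) \<Rightarrow> nat \<Rightarrow> nat \<Rightarrow> nat \<times> 'a option \<Rightarrow> bool" where
  "successor R m w s \<longleftrightarrow> (\<forall>b\<in>carrier A. R (m, Some (alg_box A b)) (w, Some b) \<and>
     (R (w, Some b) (m, Some (alg_dia A b)) \<or> R s (m, Some (alg_dia A b))))"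

text \<open>The degree is the auxiliary point of w itself, and c is the prescribed bound that this
  degree, and hence the value of w at a, must respect.\<close>

definition box_witness where
  "box_witness R m a c w \<longleftrightarrow>
     R (w, None) c \<and> \<not> R (w, None) (w, Some a) \<and> successor R m w (w, None)"

definition dia_witness where
  "dia_witness R m a w \<longleftrightarrow>
     R (m, Some (alg_dia A a)) (w, Some a) \<and> successor R m w (m, Some (alg_dia A a))"

text \<open>Ensures that a request once served stays served: extensions never change comparisons
  between existing points.\<close>

lemma witness_cong:
  assumes R: "\<And>x y. \<lbrakk>x \<in> N \<times> pts; y \<in> N \<times> pts\<rbrakk> \<Longrightarrow> R x y \<longleftrightarrow> T x y"
    and "m \<in> N" "w \<in> N" "a \<in> carrier A"
  shows "c \<in> N \<times> pts \<Longrightarrow> box_witness R m a c w \<longleftrightarrow> box_witness T m a c w"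
    and "dia_witness R m a w \<longleftrightarrow> dia_witness T m a w"
  using assms(2-) by (auto simp: box_witness_def dia_witness_def successor_def R modal_closed)

text \<open>The points of the new world outside its truth filter are inserted just above \<open>\<box>a\<close>, in
  particular below \<open>c\<close>.\<close>
lemma box_step:
  assumes S: "state N R" and m: "m \<in> N" and n: "n \<notin> N" and [simp]: "a \<in> carrier A"
    and c: "c \<in> N \<times> pts" "\<not> R c (m, Some (alg_box A a))"
  shows "\<exists>T. state (insert n N) T \<and> (\<forall>x\<in>N \<times> pts. \<forall>y\<in>N \<times> pts. T x y \<longleftrightarrow> R x y) \<and> box_witness T m a c n"
proof -
  note [simp] = modal_closed m
  obtain M where M: "prime_filt M" "\<forall>x\<in>pts. \<forall>y\<in>pts. R (m, x) (m, y) \<longleftrightarrow> fib M x y"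
    using stateD(2)[OF S m] by blast
  note RD = total_preorderD[OF stateD(1)[OF S]]
  \<comment> \<open>Some point lies strictly above \<box>a, so \<box>a is not 1 at m.\<close>
  have a: "alg_box A a \<notin> M"
  proof
    assume "alg_box A a \<in> M"
    then have "R (m, Some (alg_top A)) (m, Some (alg_box A a))"
      using M fib_top[OF M(1), of "alg_box A a" "Some (alg_top A)"] by simp
    then show False using c RD(2)[OF state_top[OF S c(1) m]] by simp
  qed
  define F where "F = {x \<in> carrier A. alg_imp A x (alg_box A a) \<notin> M}"
  obtain G where G: "M \<subseteq> F" "prime_filt F" "prime_filt G" "a \<notin> G"
    "\<forall>b\<in>carrier A. alg_box A b \<in> F \<longrightarrow> b \<in> G" "\<forall>b\<in>G. alg_dia A b \<in> F"
    using box_successor[OF M(1) \<open>a \<in> carrier A\<close> a, folded F_def] by (elim exE conjE)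
  let ?H = "\<lambda>x. \<not> R x (m, Some (alg_box A a))"
  have FH: "F = {b \<in> carrier A. ?H (m, Some b)}" using M(2) by (auto simp: F_def)
  have H: "\<forall>x\<in>N \<times> pts. \<forall>y\<in>N \<times> pts. ?H x \<longrightarrow> R x y \<longrightarrow> ?H y"
  proof (intro ballI impI notI)
    fix x y assume xy: "x \<in> N \<times> pts" "y \<in> N \<times> pts" "R x y" "R y (m, Some (alg_box A a))" and "?H x"
    then show False using RD(2)[OF xy(3,4)] by simp
  qed
  obtain T where T: "state (insert n N) T" "\<forall>x\<in>N \<times> pts. \<forall>y\<in>N \<times> pts. T x y \<longleftrightarrow> R x y"
    "\<forall>x\<in>pts. \<forall>y\<in>pts. T (n, x) (n, y) \<longleftrightarrow> fib G x y"
    "\<forall>b\<in>carrier A. T (m, Some (alg_box A b)) (n, Some b)"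
    "\<forall>b\<in>carrier A - G. T (n, Some b) (m, Some (alg_dia A b))"
    "\<forall>d\<in>pts - Some ` G. \<forall>x\<in>N \<times> pts. ?H x \<longrightarrow> T (n, d) x"
    using state_extend[where H = ?H and R = R and F = F and G = G and M = M,
        OF S m n M H FH G(2,1,3,5,6)] by (elim exE conjE)
  \<comment> \<open>For b \<in> G the value 1 may exceed \<diamond>b; then \<diamond>b is above the
    cut and so bounds the degree.\<close>
  have up: "T (n, None) (m, Some (alg_dia A b))" if "b \<in> G" for b
  proof -
    have "b \<in> carrier A" using that filtD(1)[OF prime_filtD(1)[OF G(3)]] by blast
    then show ?thesis using T(6)[rule_format, of None "(m, Some (alg_dia A b))"] G(6)[rule_format, OF that] FH by auto
  qed
  have "T (n, None) c" using T(6)[rule_format, OF _ c] by auto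
  moreover have "\<not> T (n, None) (n, Some a)" using T(3)[rule_format, of None "Some a"] G(4) by simp
  moreover have "successor T m n (n, None)" unfolding successor_def using T(4,5) up by blast
  ultimately have "box_witness T m a c n" by (simp add: box_witness_def)
  then show ?thesis using T(1,2) by blast
qed

text \<open>Here the cut starts at \<diamond>a and the degree is \<diamond>a itself. As a \<in> G,
  the new world has value 1 at a, so no approximation is involved.\<close>

lemma dia_step:
  assumes S: "state N R" and m: "m \<in> N" and n: "n \<notin> N" and [simp]: "a \<in> carrier A"
    and a': "\<not> R (m, Some (alg_dia A a)) (m, Some (alg_bot A))"
  shows "\<exists>T. state (insert n N) T \<and> (\<forall>x\<in>N \<times> pts. \<forall>y\<in>N \<times> pts. T x y \<longleftrightarrow> R x y) \<and> dia_witness T m a n"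
proof -
  note [simp] = modal_closed m
  obtain M where M: "prime_filt M" "\<forall>x\<in>pts. \<forall>y\<in>pts. R (m, x) (m, y) \<longleftrightarrow> fib M x y"
    using stateD(2)[OF S m] by blast
  note RD = total_preorderD[OF stateD(1)[OF S]]
  have a: "alg_imp A (alg_dia A a) (alg_bot A) \<notin> M" using a' M(2) by simp
  define F where "F = {x \<in> carrier A. alg_imp A (alg_dia A a) x \<in> M}"
  obtain G where G: "M \<subseteq> F" "prime_filt F" "prime_filt G" "a \<in> G"
    "\<forall>b\<in>carrier A. alg_box A b \<in> F \<longrightarrow> b \<in> G" "\<forall>b\<in>G. alg_dia A b \<in> F"
    using dia_successor[OF M(1) \<open>a \<in> carrier A\<close> a, folded F_def] by (elim exE conjE)
  let ?H = "\<lambda>x. R (m, Some (alg_dia A a)) x"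
  have FH: "F = {b \<in> carrier A. ?H (m, Some b)}" using M(2) by (auto simp: F_def)
  have H: "\<forall>x\<in>N \<times> pts. \<forall>y\<in>N \<times> pts. ?H x \<longrightarrow> R x y \<longrightarrow> ?H y"
  proof (intro ballI impI)
    fix x y assume xy: "x \<in> N \<times> pts" "y \<in> N \<times> pts" "?H x" "R x y"
    show "?H y" using RD(2)[OF xy(3,4) _ xy(1,2)] by simp
  qed
  obtain T where T: "state (insert n N) T" "\<forall>x\<in>N \<times> pts. \<forall>y\<in>N \<times> pts. T x y \<longleftrightarrow> R x y"
    "\<forall>x\<in>pts. \<forall>y\<in>pts. T (n, x) (n, y) \<longleftrightarrow> fib G x y"
    "\<forall>b\<in>carrier A. T (m, Some (alg_box A b)) (n, Some b)"
    "\<forall>b\<in>carrier A - G. T (n, Some b) (m, Some (alg_dia A b))"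
    "\<forall>d\<in>pts - Some ` G. \<forall>x\<in>N \<times> pts. ?H x \<longrightarrow> T (n, d) x"
    using state_extend[where H = ?H and R = R and F = F and G = G and M = M,
        OF S m n M H FH G(2,1,3,5,6)] by (elim exE conjE)
  have up: "T (m, Some (alg_dia A a)) (m, Some (alg_dia A b))" if "b \<in> G" for b
  proof -
    have "b \<in> carrier A" using that filtD(1)[OF prime_filtD(1)[OF G(3)]] by blast
    then show ?thesis using T(2) G(6)[rule_format, OF that] FH by auto
  qed
  have "T (m, Some (alg_dia A a)) (n, Some (alg_top A))" using state_top[OF T(1)] by simp
  moreover have "T (n, Some (alg_top A)) (n, Some a)" using T(3) fib_top[OF G(3,4), of "Some (alg_top A)"] by simp
  ultimately have "T (m, Some (alg_dia A a)) (n, Some a)"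
    by (rule total_preorderD(2)[OF stateD(1)[OF T(1)]]) simp_all
  moreover have "successor T m n (m, Some (alg_dia A a))"
    unfolding successor_def using T(4,5) up by blast
  ultimately have "dia_witness T m a n" by (simp add: dia_witness_def)
  then show ?thesis using T(1,2) by blast
qed

text \<open>A request is a tuple (k, m, a, c), where k selects \<box> or \<diamond>; requests that
  do not apply leave the state alone. Finiteness of \<open>N\<close> supplies a fresh world.\<close>

lemma state_step:
  assumes S: "state N R" and "finite N"
  shows "\<exists>N' T. state N' T \<and> finite N' \<and> N \<subseteq> N' \<and> (\<forall>x\<in>N \<times> pts. \<forall>y\<in>N \<times> pts. T x y \<longleftrightarrow> R x y) \<and>
    (m \<in> N \<and> a \<in> carrier A \<and> c \<in> N \<times> pts \<longrightarrow>
      (k \<longrightarrow> \<not> R c (m, Some (alg_box A a)) \<longrightarrow> (\<exists>w\<in>N'. box_witness T m a c w)) \<and>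
      (\<not> k \<longrightarrow> \<not> R (m, Some (alg_dia A a)) (m, Some (alg_bot A)) \<longrightarrow> (\<exists>w\<in>N'. dia_witness T m a w)))"
    (is "\<exists>N' T. ?P N' T")
proof -
  obtain n where n: "n \<notin> N" using ex_new_if_finite[OF infinite_UNIV_nat \<open>finite N\<close>] by blast
  consider
    "m \<in> N" "a \<in> carrier A" "c \<in> N \<times> pts" "k" "\<not> R c (m, Some (alg_box A a))" |
    "m \<in> N" "a \<in> carrier A" "c \<in> N \<times> pts" "\<not> k" "\<not> R (m, Some (alg_dia A a)) (m, Some (alg_bot A))" |
    "m \<in> N \<and> a \<in> carrier A \<and> c \<in> N \<times> pts \<longrightarrow> (k \<longrightarrow> R c (m, Some (alg_box A a))) \<and>
      (\<not> k \<longrightarrow> R (m, Some (alg_dia A a)) (m, Some (alg_bot A)))"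
    by blast
  then show ?thesis
  proof cases
    case 1
    obtain T where "state (insert n N) T" "\<forall>x\<in>N \<times> pts. \<forall>y\<in>N \<times> pts. T x y \<longleftrightarrow> R x y" "box_witness T m a c n"
      using box_step[OF S 1(1) n 1(2,3,5)] by blast
    then have "?P (insert n N) T" using 1(4) \<open>finite N\<close> by (simp add: subset_insertI)
    then show ?thesis by blast
  next
    case 2
    obtain T where "state (insert n N) T" "\<forall>x\<in>N \<times> pts. \<forall>y\<in>N \<times> pts. T x y \<longleftrightarrow> R x y" "dia_witness T m a n"
      using dia_step[OF S 2(1) n 2(2,5)] by blast
    then have "?P (insert n N) T" using 2(4) \<open>finite N\<close> by (simp add: subset_insertI)
    then show ?thesis by blast
  next
    case 3
    then have "?P N R" using S \<open>finite N\<close> by simp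
    then show ?thesis by blast
  qed
qed

section \<open>The limit of all extensions\<close>

definition complete_state :: "nat set \<Rightarrow> (nat \<times> 'a option \<Rightarrow> nat \<times> 'a option \<Rightarrow> bool) \<Rightarrow> bool" where
  "complete_state N R \<longleftrightarrow> state N R \<and> (\<forall>m\<in>N. \<forall>a\<in>carrier A.
     (\<forall>c\<in>N \<times> pts. \<not> R c (m, Some (alg_box A a)) \<longrightarrow> (\<exists>w\<in>N. box_witness R m a c w)) \<and>
     (\<not> R (m, Some (alg_dia A a)) (m, Some (alg_bot A)) \<longrightarrow> (\<exists>w\<in>N. dia_witness R m a w)))"

text \<open>Each clause involves at most three points, or one world, and these occur together at
  some stage.\<close>

lemma state_chain_union:
  fixes N :: "nat \<Rightarrow> nat set"
  assumes S: "\<And>i. state (N i) (R i)" and mono: "\<And>i j. i \<le> j \<Longrightarrow> N i \<subseteq> N j"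
    and agree: "\<And>i x y. \<lbrakk>x \<in> N i \<times> pts; y \<in> N i \<times> pts\<rbrakk> \<Longrightarrow> T x y \<longleftrightarrow> R i x y"
  shows "state (\<Union>i. N i) T"
proof -
  let ?N = "\<Union>i. N i"
  have ex3: "\<exists>i. x \<in> N i \<and> y \<in> N i \<and> z \<in> N i" if "x \<in> ?N" "y \<in> ?N" "z \<in> ?N" for x y z
  proof -
    obtain i j k where "x \<in> N i" "y \<in> N j" "z \<in> N k" using \<open>x \<in> ?N\<close> \<open>y \<in> ?N\<close> \<open>z \<in> ?N\<close> by blast
    moreover define l where "l = max i (max j k)"
    then have "N i \<subseteq> N l" "N j \<subseteq> N l" "N k \<subseteq> N l" using mono by auto
    ultimately show ?thesis by blast
  qed
  note RD = total_preorderD[OF stateD(1)[OF S]]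
  show ?thesis unfolding state_def
  proof (intro conjI ballI)
    show "total_preorder (?N \<times> pts) T" unfolding total_preorder_def
    proof (intro conjI ballI impI)
      fix x y assume "x \<in> ?N \<times> pts" "y \<in> ?N \<times> pts"
      then obtain i where i: "x \<in> N i \<times> pts" "y \<in> N i \<times> pts"
        using ex3[of "fst x" "fst y" "fst y"] by (auto simp: mem_Times_iff)
      show "T x y \<or> T y x" using agree[OF i] agree[OF i(2,1)] RD(1)[OF i] by blast
    next
      fix x y z assume xyz: "x \<in> ?N \<times> pts" "y \<in> ?N \<times> pts" "z \<in> ?N \<times> pts" and T: "T x y" "T y z"
      then obtain i where i: "x \<in> N i \<times> pts" "y \<in> N i \<times> pts" "z \<in> N i \<times> pts"
        using ex3[of "fst x" "fst y" "fst z"] by (auto simp: mem_Times_iff)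
      have "R i x y" "R i y z" using T agree[OF i(1,2)] agree[OF i(2,3)] by simp_all
      from RD(2)[OF this i] show "T x z" using agree[OF i(1,3)] by simp
    qed
  next
    fix m assume "m \<in> ?N"
    then obtain i where i: "m \<in> N i" by blast
    obtain M where M: "prime_filt M" "\<forall>x\<in>pts. \<forall>y\<in>pts. R i (m, x) (m, y) \<longleftrightarrow> fib M x y"
      using stateD(2)[OF S i] by blast
    have "\<forall>x\<in>pts. \<forall>y\<in>pts. T (m, x) (m, y) \<longleftrightarrow> fib M x y"
      using i agree[of _ i] M(2) by simp
    then show "\<exists>M. prime_filt M \<and> (\<forall>x\<in>pts. \<forall>y\<in>pts. T (m, x) (m, y) \<longleftrightarrow> fib M x y)"
      using M(1) by blast
  next
    fix m n assume "m \<in> ?N" "n \<in> ?N"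
    then obtain i where i: "m \<in> N i" "n \<in> N i" using ex3[of m n n] by blast
    show "T (m, Some (alg_bot A)) (n, Some (alg_bot A))" "T (m, Some (alg_top A)) (n, Some (alg_top A))"
      using agree[of _ i] i stateD(3,4)[OF S i] by (simp_all add: closed)
  qed
qed

lemma complete_state_exists:
  assumes cnt: "countable (carrier A)" and S0: "state N0 R0" "finite N0"
  shows "\<exists>N R. complete_state N R \<and> N0 \<subseteq> N \<and> (\<forall>x\<in>N0 \<times> pts. \<forall>y\<in>N0 \<times> pts. R x y \<longleftrightarrow> R0 x y)"
proof -
  define Req where "Req = (UNIV :: bool set) \<times> (UNIV :: nat set) \<times> carrier A \<times> (UNIV :: nat set) \<times> pts"
  have "countable Req"
    using cnt by (auto simp: Req_def pts_def)
  \<comment> \<open>Only the first component of the decoded pair selects the request, so each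
    request recurs at arbitrarily late stages, after its world m and its bound c have come into
    being.\<close>
  define req where "req i = from_nat_into Req (fst (prod_decode i))" for i
  define Q where "Q i = (\<lambda>(N, R) (N', T). N \<subseteq> N' \<and> (\<forall>x\<in>N \<times> pts. \<forall>y\<in>N \<times> pts. T x y \<longleftrightarrow> R x y) \<and>
    (case req i of (k, m, a, c) \<Rightarrow> m \<in> N \<and> a \<in> carrier A \<and> c \<in> N \<times> pts \<longrightarrow>
      (k \<longrightarrow> \<not> R c (m, Some (alg_box A a)) \<longrightarrow> (\<exists>w\<in>N'. box_witness T m a c w)) \<and>
      (\<not> k \<longrightarrow> \<not> R (m, Some (alg_dia A a)) (m, Some (alg_bot A)) \<longrightarrow> (\<exists>w\<in>N'. dia_witness T m a w))))" for i
  \<comment> \<open>The clause for i = 0 pins the initial state, which dependent choice would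
    otherwise leave open.\<close>
  define P where "P i = (\<lambda>(N, R). state N R \<and> finite N \<and> (i = 0 \<longrightarrow> (N, R) = (N0, R0)))" for i :: nat
  have "\<exists>f. \<forall>i. P i (f i) \<and> Q i (f i) (f (Suc i))"
  proof (rule dependent_nat_choice)
    show "\<exists>x. P 0 x" using S0 by (auto simp: P_def)
    fix x i assume "P i x"
    obtain N R where [simp]: "x = (N, R)" by (cases x)
    have "state N R" "finite N" using \<open>P i x\<close> by (simp_all add: P_def)
    obtain k m a c where [simp]: "req i = (k, m, a, c)" by (cases "req i")
    show "\<exists>y. P (Suc i) y \<and> Q i x y"
      using state_step[OF \<open>state N R\<close> \<open>finite N\<close>, of m a c k] unfolding P_def Q_def by simp
  qed
  then obtain f where f: "\<And>i. P i (f i)" "\<And>i. Q i (f i) (f (Suc i))" by blast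
  define N where "N i = fst (f i)" for i
  define R where "R i = snd (f i)" for i
  have fi: "f i = (N i, R i)" for i by (simp add: N_def R_def)
  have S: "state (N i) (R i)" for i using f(1)[of i] by (simp add: P_def fi)
  have 0: "N 0 = N0" "R 0 = R0" using f(1)[of 0] by (simp_all add: P_def fi)
  have suc: "N i \<subseteq> N (Suc i)" "\<And>x y. \<lbrakk>x \<in> N i \<times> pts; y \<in> N i \<times> pts\<rbrakk> \<Longrightarrow> R (Suc i) x y \<longleftrightarrow> R i x y" for i
    using f(2)[of i] unfolding Q_def fi by blast+
  have mono: "N i \<subseteq> N j" if "i \<le> j" for i j by (rule lift_Suc_mono_le[of N, OF suc(1) that])
  have agree: "R j x y \<longleftrightarrow> R i x y" if "i \<le> j" and mem: "x \<in> N i \<times> pts" "y \<in> N i \<times> pts" for i j x y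
    using that(1)
  proof (induction j rule: dec_induct)
    case (step j)
    have "x \<in> N j \<times> pts" "y \<in> N j \<times> pts" using mem mono[OF step(1)] by auto
    then show ?case using suc(2) step by simp
  qed simp
  define T where "T = (\<lambda>x y. \<exists>i. x \<in> N i \<times> pts \<and> y \<in> N i \<times> pts \<and> R i x y)"
  have TR: "T x y \<longleftrightarrow> R i x y" if mem: "x \<in> N i \<times> pts" "y \<in> N i \<times> pts" for i x y
  proof -
    have "R i x y" if j: "x \<in> N j \<times> pts" "y \<in> N j \<times> pts" "R j x y" for j
      using agree[OF max.cobounded1 mem, of j] agree[OF max.cobounded2 j(1,2), of i] j(3) by simp
    then show ?thesis using mem unfolding T_def by blast
  qed
  let ?N = "\<Union>i. N i"
  have state: "state ?N T" by (rule state_chain_union[OF S mono TR])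
  have served: "(k \<longrightarrow> \<not> T c (m, Some (alg_box A a)) \<longrightarrow> (\<exists>w\<in>?N. box_witness T m a c w)) \<and>
      (\<not> k \<longrightarrow> \<not> T (m, Some (alg_dia A a)) (m, Some (alg_bot A)) \<longrightarrow> (\<exists>w\<in>?N. dia_witness T m a w))"
    if m: "m \<in> ?N" and a: "a \<in> carrier A" and c: "c \<in> ?N \<times> pts" for k m a c
  proof -
    obtain i j where ij: "m \<in> N i" "c \<in> N j \<times> pts" using m c by (auto simp: mem_Times_iff)
    have "(k, m, a, c) \<in> Req" using a c by (auto simp: Req_def)
    then obtain r where r: "from_nat_into Req r = (k, m, a, c)"
      using from_nat_into_surj[OF \<open>countable Req\<close>] by blast
    \<comment> \<open>A pair code is at least its second component, so m and c exist at stage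
      \<open>l\<close>.\<close>
    define l where "l = prod_encode (r, max i j)"
    have "max i j \<le> l" unfolding l_def by (rule le_prod_encode_2)
    then have "N i \<subseteq> N l" "N j \<subseteq> N l" using mono by simp_all
    then have l: "m \<in> N l" "c \<in> N l \<times> pts" using ij by auto
    then have l': "m \<in> N (Suc l)" "c \<in> N (Suc l) \<times> pts" using suc(1)[of l] by auto
    have "T c (m, Some (alg_box A a)) \<longleftrightarrow> R l c (m, Some (alg_box A a))"
      "T (m, Some (alg_dia A a)) (m, Some (alg_bot A)) \<longleftrightarrow> R l (m, Some (alg_dia A a)) (m, Some (alg_bot A))"
      using l a by (simp_all add: TR modal_closed)
    moreover have "box_witness T m a c w \<longleftrightarrow> box_witness (R (Suc l)) m a c w"
      and "dia_witness T m a w \<longleftrightarrow> dia_witness (R (Suc l)) m a w" if "w \<in> N (Suc l)" for w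
      using witness_cong[of "N (Suc l)" T "R (Suc l)", OF TR l'(1) that a] l'(2) by simp_all
    moreover have "(k \<longrightarrow> \<not> R l c (m, Some (alg_box A a)) \<longrightarrow> (\<exists>w\<in>N (Suc l). box_witness (R (Suc l)) m a c w)) \<and>
      (\<not> k \<longrightarrow> \<not> R l (m, Some (alg_dia A a)) (m, Some (alg_bot A)) \<longrightarrow> (\<exists>w\<in>N (Suc l). dia_witness (R (Suc l)) m a w))"
      using f(2)[of l] l a by (simp add: Q_def fi req_def l_def r)
    ultimately show ?thesis by blast
  qed
  have "complete_state ?N T" unfolding complete_state_def
  proof (intro conjI ballI impI)
    fix m a assume m: "m \<in> ?N" and a: "a \<in> carrier A"
    { fix c assume "c \<in> ?N \<times> pts" "\<not> T c (m, Some (alg_box A a))"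
      then show "\<exists>w\<in>?N. box_witness T m a c w" using served[OF m a, of c True] by simp }
    assume "\<not> T (m, Some (alg_dia A a)) (m, Some (alg_bot A))"
    \<comment> \<open>All requests have the same shape, so a \<diamond> request also names a
      point.\<close>
    moreover have "(m, None) \<in> ?N \<times> pts" using m by simp
    ultimately show "\<exists>w\<in>?N. dia_witness T m a w" using served[OF m a, of "(m, None)" False] by simp
  qed (rule state)
  moreover have "N0 \<subseteq> ?N" using 0 by blast
  moreover have "\<forall>x\<in>N0 \<times> pts. \<forall>y\<in>N0 \<times> pts. T x y \<longleftrightarrow> R0 x y"
    using TR[where i = 0] unfolding 0 by blast
  ultimately show ?thesis by blast
qed

end

section \<open>Realization in the unit interval\<close>

context bimodal_godel_algebra
begin

text \<open>The order-theoretic witnesses become metric ones: as the embedding preserves infima,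
  being strictly below a suitable c above \<box>a amounts to being within \<epsilon> of v (\<box>a),
  and a complete state has a witness for every such c.\<close>

lemma complete_state_saturated:
  assumes cnt: "countable (carrier A)" and C: "complete_state N R" and i0: "i0 \<in> N"
  shows "\<exists>f. saturated ((\<lambda>i b. f (i, Some b)) ` N) \<and>
    (\<forall>x\<in>N \<times> pts. \<forall>y\<in>N \<times> pts. f x \<le> f y \<longleftrightarrow> R x y) \<and>
    (\<forall>i\<in>N. f (i, Some (alg_top A)) = (1 :: real))"
proof -
  note [simp] = modal_closed
  have S: "state N R" using C by (simp add: complete_state_def)
  note R = stateD(1)[OF S]
  note RD = total_preorderD[OF R]
  let ?b = "(i0, Some (alg_bot A))" and ?t = "(i0, Some (alg_top A))"
  have cX: "countable (N \<times> pts)" using cnt by (auto simp: pts_def)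
  have bt: "?b \<in> N \<times> pts" "?t \<in> N \<times> pts" using i0 by auto
  have tb: "\<not> R ?t ?b"
  proof
    assume *: "R ?t ?b"
    obtain M where M: "prime_filt M" "\<forall>x\<in>pts. \<forall>y\<in>pts. R (i0, x) (i0, y) \<longleftrightarrow> fib M x y"
      using stateD(2)[OF S i0] by blast
    note F = prime_filtD(1)[OF M(1)]
    have i: "alg_imp A (alg_top A) (alg_bot A) \<in> M" using * M(2) by simp
    have "alg_bot A \<in> M" by (rule filt_mp[OF F filtD(2)[OF F] i]) simp
    then show False using prime_filtD(2)[OF M(1)] by simp
  qed
  have ends: "\<forall>x\<in>N \<times> pts. R ?b x" "\<forall>x\<in>N \<times> pts. R x ?t"
    using state_bot[OF S _ i0] state_top[OF S _ i0] by blast+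
  obtain f :: "nat \<times> 'a option \<Rightarrow> real" where f': "\<forall>x\<in>N \<times> pts. f x \<in> {0..1}"
    "\<forall>x\<in>N \<times> pts. \<forall>y\<in>N \<times> pts. f x \<le> f y \<longleftrightarrow> R x y" "f ?b = 0" "f ?t = 1"
    "\<forall>x\<in>N \<times> pts. \<forall>\<epsilon>>0. \<not> R ?t x \<longrightarrow>
      (\<exists>c\<in>N \<times> pts. \<not> R c x \<and> (\<forall>y\<in>N \<times> pts. \<not> R c y \<longrightarrow> f y < f x + \<epsilon>))"
    using total_preorder_embed_real[OF R cX bt tb ends]
    by (elim exE conjE)
  note f = f'(1)[rule_format] f'(2)[rule_format] f'(3,4) f'(5)[rule_format]
  have bot: "f (i, Some (alg_bot A)) = 0" and top: "f (i, Some (alg_top A)) = 1" if i: "i \<in> N" for i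
  proof -
    show "f (i, Some (alg_bot A)) = 0"
      using f(2)[of "(i, Some (alg_bot A))" ?b] f(1)[of "(i, Some (alg_bot A))"] f(3) stateD(3)[OF S i i0] i i0 by simp
    show "f (i, Some (alg_top A)) = 1"
      using f(2)[of ?t "(i, Some (alg_top A))"] f(1)[of "(i, Some (alg_top A))"] f(4) stateD(4)[OF S i0 i] i i0 by simp
  qed
  let ?w = "\<lambda>i b. f (i, Some b)"
  have hom: "godel_hom (?w i)" if i: "i \<in> N" for i
  proof -
    obtain M where M: "prime_filt M" "\<forall>x\<in>pts. \<forall>y\<in>pts. R (i, x) (i, y) \<longleftrightarrow> fib M x y"
      using stateD(2)[OF S i] by blast
    have g: "?w i b \<le> ?w i c \<longleftrightarrow> alg_imp A b c \<in> M" if "b \<in> carrier A" "c \<in> carrier A" for b c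
      using f(2)[of "(i, Some b)" "(i, Some c)"] M(2) i that by simp
    show ?thesis unfolding godel_hom_def
      using chain_hom[of M "?w i", OF M(1) g top[OF i]] f(1)[of "(i, Some _)"] bot[OF i] top[OF i] i by simp
  qed
  have acc: "acc_ge (f s) (?w m) (?w w)" if "successor R m w s" "m \<in> N" "w \<in> N" "s \<in> N \<times> pts" for m w s
    using that by (simp add: acc_ge_def successor_def f(2))
  have "saturated (?w ` N)" unfolding saturated_def
  proof (intro conjI ballI allI impI)
    fix v assume "v \<in> ?w ` N"
    then show "godel_hom v" using hom by blast
  next
    fix v a \<epsilon> assume "v \<in> ?w ` N" and a[simp]: "a \<in> carrier A" and \<epsilon>: "0 < (\<epsilon> :: real)" and less: "v (alg_box A a) < 1"
    then obtain m where m[simp]: "m \<in> N" and v: "v = ?w m" by blast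
    let ?x = "(m, Some (alg_box A a))"
    have x: "?x \<in> N \<times> pts" by simp
    have "\<not> R ?t ?x" using f(2)[OF bt(2) x] less f(4) v by simp
    then obtain c where c: "c \<in> N \<times> pts" "\<not> R c ?x" "\<forall>y\<in>N \<times> pts. \<not> R c y \<longrightarrow> f y < f ?x + \<epsilon>"
      using f(5)[OF x \<epsilon>] by blast
    obtain w where w[simp]: "w \<in> N" and bw: "box_witness R m a c w"
      using C c(1,2) m a unfolding complete_state_def by blast
    have 1: "R (w, None) c" "\<not> R (w, None) (w, Some a)" "successor R m w (w, None)"
      using bw by (simp_all add: box_witness_def)
    \<comment> \<open>The value at a is strictly below the auxiliary point, which is at most
      c.\<close>
    have "\<not> R c (w, Some a)" using 1(2) RD(2)[OF 1(1) _ _ c(1), of "(w, Some a)"] by auto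
    then have "?w w a < v (alg_box A a) + \<epsilon>" using c(3) v by simp
    moreover have "?w w a < f (w, None)" using 1(2) f(2)[of "(w, None)" "(w, Some a)"] by simp
    moreover have "f (w, None) \<le> 1" using f(1)[of "(w, None)"] by simp
    moreover have "acc_ge (f (w, None)) v (?w w)" using acc[OF 1(3)] v by simp
    ultimately show "\<exists>w\<in>?w ` N. \<exists>s\<le>1. w a < s \<and> w a < v (alg_box A a) + \<epsilon> \<and> acc_ge s v w"
      using w unfolding bex_simps(7) by blast
  next
    fix v a assume "v \<in> ?w ` N" and a[simp]: "a \<in> carrier A" and less: "0 < v (alg_dia A a)"
    then obtain m where m[simp]: "m \<in> N" and v: "v = ?w m" by blast
    have "\<not> R (m, Some (alg_dia A a)) (m, Some (alg_bot A))"
      using f(2)[of "(m, Some (alg_dia A a))" "(m, Some (alg_bot A))"] bot[OF m] less v by simp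
    then obtain w where w[simp]: "w \<in> N" and dw: "dia_witness R m a w"
      using C m a unfolding complete_state_def by blast
    have 1: "R (m, Some (alg_dia A a)) (w, Some a)" "successor R m w (m, Some (alg_dia A a))"
      using dw by (simp_all add: dia_witness_def)
    have "v (alg_dia A a) \<le> ?w w a" using 1(1) f(2)[of "(m, Some (alg_dia A a))" "(w, Some a)"] v by simp
    moreover have "acc_ge (v (alg_dia A a)) v (?w w)" using acc[OF 1(2)] v by simp
    ultimately show "\<exists>w\<in>?w ` N. v (alg_dia A a) \<le> w a \<and> acc_ge (v (alg_dia A a)) v w"
      using w unfolding bex_simps(7) by blast
  qed
  then show ?thesis using f'(2) top by blast
qed

lemma prime_filter_separates:
  assumes [simp]: "a \<in> carrier A" and ne: "a \<noteq> alg_top A"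
  obtains (sep) G where "prime_filt G" "a \<notin> G"
proof -
  let ?J = "{x \<in> carrier A. alg_le A x a}"
  show ?thesis
  proof (rule prime_filter_exists[of "{alg_top A}" ?J])
    show "filt {alg_top A}" unfolding filt_def
      using meet_idem[OF top_closed] le_antisym[OF _ top_greatest] top_closed by auto
    show "{alg_top A} \<inter> ?J = {}"
      using ne le_antisym[OF top_greatest, of a] top_closed by auto
    show "alg_bot A \<in> ?J" using bot_least bot_closed by simp
    show "alg_join A x y \<in> ?J" if "x \<in> ?J" "y \<in> ?J" for x y
      using that by (simp add: join_least join_closed)
    show "y \<in> ?J" if "x \<in> ?J" "y \<in> carrier A" "alg_le A y x" for x y
      using that le_trans[OF that(3), of a] by simp
    show thesis if "prime_filt G" "G \<inter> ?J = {}" for G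
    proof (rule sep)
      show "prime_filt G" by fact
      show "a \<notin> G" using that(2) le_refl[of a] by auto
    qed
  qed auto
qed

lemma saturated_exists:
  assumes cnt: "countable (carrier A)" and a[simp]: "a \<in> carrier A" and ne: "a \<noteq> alg_top A"
  shows "\<exists>W. saturated W \<and> (\<exists>w\<in>W. w a < 1)"
proof -
  note [simp] = closed
  obtain G where G: "prime_filt G" "a \<notin> G" using prime_filter_separates[OF a ne] .
  note F = prime_filtD(1)[OF G(1)]
  define R0 where "R0 = (\<lambda>(i :: nat, x) (j :: nat, y). fib G x y)"
  have "total_preorder ({0} \<times> pts) R0"
    using total_preorderD(1)[OF fib_total_preorder[OF G(1)]] fib_trans[OF G(1)]
    unfolding total_preorder_def R0_def by blast
  then have S0: "state {0} R0"
    unfolding state_def using G(1) filt_imp_le[OF F le_refl] by (auto simp: R0_def)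
  obtain N R where N: "complete_state N R" "{0} \<subseteq> N"
    "\<forall>x\<in>{0} \<times> pts. \<forall>y\<in>{0} \<times> pts. R x y \<longleftrightarrow> R0 x y"
    using complete_state_exists[OF cnt S0] by blast
  have 0: "0 \<in> N" using N(2) by simp
  obtain f where f: "saturated ((\<lambda>i b. f (i, Some b)) ` N)"
    "\<forall>x\<in>N \<times> pts. \<forall>y\<in>N \<times> pts. f x \<le> f y \<longleftrightarrow> R x y"
    "\<forall>i\<in>N. f (i, Some (alg_top A)) = (1 :: real)"
    using complete_state_saturated[OF cnt N(1) 0] by (elim exE conjE)
  have "\<not> R (0, Some (alg_top A)) (0, Some a)"
  proof
    assume "R (0, Some (alg_top A)) (0, Some a)"
    then have i: "alg_imp A (alg_top A) a \<in> G" using N(3) by (simp add: R0_def)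
    have "a \<in> G" by (rule filt_mp[OF F filtD(2)[OF F] i a])
    then show False using G(2) by simp
  qed
  define w where "w = (\<lambda>b. f (0, Some b))"
  have "w a < 1" unfolding w_def
    using \<open>\<not> R (0, Some (alg_top A)) (0, Some a)\<close> f(2)[rule_format, of "(0, Some (alg_top A))" "(0, Some a)"] f(3) 0 by simp
  moreover have "w \<in> (\<lambda>i b. f (i, Some b)) ` N" using 0 by (simp add: w_def)
  ultimately show ?thesis
    using f(1) by (intro exI[of _ "(\<lambda>i b. f (i, Some b)) ` N"] conjI bexI[of _ w])
qed

end

theorem theorem6p2:
  fixes A :: "'a bimodal_algebra"
  assumes "bimodal_godel_algebra A"
    and "countable (carrier A)"
    and "alg_bot A \<noteq> alg_top A"
  shows "\<exists>(W :: ('a \<Rightarrow> real) set) S. gk_frame W S \<and>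
    (\<exists>h. bimodal_embedding A (complex_algebra W S) h) \<and>
    (\<forall>v :: 'v \<Rightarrow> 'a. alg_valuation A v \<longrightarrow>
      (\<exists>e. gk_model W S e \<and>
        (\<forall>\<phi>. alg_eval A v \<phi> = alg_top A \<longleftrightarrow> gk_valid W S e \<phi>)))"
proof -
  interpret bimodal_godel_algebra A by fact
  \<comment> \<open>Each construction keeps just one given element below 1; their union separates
    all at once, and the frame may be of any size.\<close>
  let ?W = "\<Union>{W. saturated W}"
  have sat: "saturated ?W" by (rule saturated_Union) simp
  have sep: "\<exists>w\<in>?W. w a < 1" if "a \<in> carrier A" "a \<noteq> alg_top A" for a
    using saturated_exists[OF assms(2) that] by blast
  \<comment> \<open>A frame needs a world, and 0 \<noteq> 1 provides one.\<close>
  have "?W \<noteq> {}" using sep[OF bot_closed assms(3)] by blast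
  then have frame: "gk_frame ?W acc" by (rule saturated_frame[OF sat])
  have emb: "bimodal_embedding A (complex_algebra ?W acc) (\<lambda>a. \<lambda>w\<in>?W. w a)"
    by (rule saturated_embedding[OF sat sep])
  show ?thesis
    using frame emb embedding_gk_valid[OF frame emb] by blast
qed

end
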